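(* Let $n,k$ be integers with $1\le k\le \lfloor n/2\rfloor$, and let $\mathcal{O}(n,k)$ be the set of trees of order $n$ having exactly $2k$ odd vertices. If $T\in\mathcal{O}(n,k)$ has minimum Mostar index among all trees in $\mathcal{O}(n,k)$, then $T\cong C_{n,\lceil\frac{k-1}{2}\rceil,\lfloor\frac{k-1}{2}\rfloor}$.
   Context: For a connected simple graph $G$, the Mostar index is $Mo(G)=\sum_{uv\in E(G)}|n_u-n_v|$, where for an edge $e=uv$, $n_u$ is the number of vertices of $G$ closer (in graph distance) to $u$ than to $v$, and $n_v$ is the number of vertices closer to $v$ than to $u$. The order of a graph is its number of vertices. A vertex is odd if its degree is odd. For integers $a,b\ge 0$ with $2(a+b)\le n-1$, $C_{n,a,b}$ is the tree obtained from the path $P_{n-a-b}=v_1v_2\dots v_{n-a-b}$ by attaching a pendent vertex $u_i$ to $v_i$ for each $i$ with $2\le i\le a+1$ and each $i$ with $n-a-2b\le i\le n-a-b-1$. In particular $C_{n,0,0}=P_n$, the path on $n$ vertices. *)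

theory Defs
  imports "Graph_Theory.Graph_Theory"
begin

text \<open>
  Finite simple graphs are \<^term>\<open>pair_graph\<close>s: every edge \<open>uv\<close> is present as the two arcs
  \<open>(u, v)\<close> and \<open>(v, u)\<close>, and the out-degree of a vertex is its degree.
\<close>

text \<open>
  The predicate \<^const>\<open>tree\<close> of the library is not usable here: in a symmetric digraph the two
  arcs of an edge already form a \<^const>\<open>pre_digraph.cycle\<close>. The cycles of the undirected graph
  are those of length at least 3.
\<close>

definition undirected_tree :: "'a pair_pre_digraph \<Rightarrow> bool" where
  "undirected_tree G \<longleftrightarrow> pair_graph G \<and> Digraph_Component.connected (with_proj G) \<and>
     \<not> (\<exists>p. pre_digraph.cycle (with_proj G) p \<and> 3 \<le> length p)"

definition gdist :: "'a pair_pre_digraph \<Rightarrow> 'a \<Rightarrow> 'a \<Rightarrow> ereal" where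
  "gdist G u v = wf_digraph.\<mu> (with_proj G) (\<lambda>_. 1) u v"

definition n_closer :: "'a pair_pre_digraph \<Rightarrow> 'a \<Rightarrow> 'a \<Rightarrow> nat" where
  "n_closer G u v = card {x \<in> pverts G. gdist G x u < gdist G x v}"

definition edges :: "'a pair_pre_digraph \<Rightarrow> 'a set set" where
  "edges G = {{u, v} | u v. (u, v) \<in> parcs G}"

text \<open>
  The summand is symmetric in \<open>u\<close> and \<open>v\<close>, so it depends on the edge only and the description
  is well defined.
\<close>

definition mostar :: "'a pair_pre_digraph \<Rightarrow> int" where
  "mostar G = (\<Sum>e\<in>edges G. THE d. \<exists>u v. e = {u, v} \<and>
     d = \<bar>int (n_closer G u v) - int (n_closer G v u)\<bar>)"

definition odd_vertices :: "'a pair_pre_digraph \<Rightarrow> 'a set" where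
  "odd_vertices G = {v \<in> pverts G. odd (out_degree (with_proj G) v)}"

definition odd_trees :: "nat \<Rightarrow> nat \<Rightarrow> 'a pair_pre_digraph set" where
  "odd_trees n k =
     {G. undirected_tree G \<and> card (pverts G) = n \<and> card (odd_vertices G) = 2 * k}"

datatype cvertex = V nat | U nat

text \<open>
  \<open>C_graph n a b\<close> is meant for \<open>2 * (a + b) \<le> n - 1\<close> with \<open>1 \<le> n\<close>, where no subtraction below
  truncates. The two ranges of indices are disjoint, so that the order is \<open>n\<close>, unless
  \<open>2 * (a + b) = n - 1\<close> with \<open>a\<close> and \<open>b\<close> positive.
\<close>

definition pendant_indices :: "nat \<Rightarrow> nat \<Rightarrow> nat \<Rightarrow> nat set" where
  "pendant_indices n a b = {2..a + 1} \<union> {n - a - 2 * b..n - a - b - 1}"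

definition C_graph :: "nat \<Rightarrow> nat \<Rightarrow> nat \<Rightarrow> cvertex pair_pre_digraph" where
  "C_graph n a b = \<lparr>
     pverts = V ` {1..n - a - b} \<union> U ` pendant_indices n a b,
     parcs = (let E = {(V i, V (i + 1)) | i. 1 \<le> i \<and> i < n - a - b} \<union>
                      {(V i, U i) | i. i \<in> pendant_indices n a b}
              in E \<union> E\<inverse>)\<rparr>"

end

theory Submission
  imports Defs "HOL-Library.Multiset"
begin

text \<open>
  An edge splitting a tree of order \<open>n\<close> into parts of sizes \<open>m \<le> n - m\<close> contributes \<open>n - 2 m\<close>, so
  minimising the Mostar index means maximising the sum \<open>S\<close> of the smaller sides \<open>m\<close> over all edges.
  Both parts \<open>u\<close>, \<open>w\<close> are rooted trees at the ends of the edge, and they contain \<open>2 h(u) + 1\<close> and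
  \<open>2 h(w) + 1\<close> odd vertices, where \<open>h(u) + h(w) = k - 1\<close>.

  For a rooted part \<open>u\<close> of order \<open>s\<close>, the sum of the orders of all its rooted subtrees is at most
  \<open>s (s + 1) / 2 - h(u)\<^sup>2\<close>, with equality only for a path whose lower end carries a
  pendent vertex at each inner position. Summed over the two parts of a balanced edge, this bounds \<open>S\<close> by
  \<open>\<lfloor>n/2\<rfloor> \<lceil>n/2\<rceil> - h(u)\<^sup>2 - h(w)\<^sup>2\<close>, and the maximum, attained for balanced \<open>h\<close>, forces the shape of
  \<open>C\<close>.

  That an optimal tree has a balanced edge follows by counting the edges whose smaller side is at
  least \<open>m\<close>: if there is one, splitting there shows that there are at most
  \<open>n - max (k + 2 \<lfloor>m/2\<rfloor>) (2 m - 1)\<close> of them. Summing over \<open>m\<close> gives the same bound on \<open>S\<close>, and it is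
  strict if the layer \<open>m = \<lfloor>n/2\<rfloor>\<close> is empty. The only exception is \<open>n = 2 k\<close> with \<open>k\<close> even,
  where the bound on the last layer is 0; then the layer below it is nonempty, and splitting at an
  edge with smaller side \<open>k - 1\<close> gives the same bound on \<open>S\<close>.
\<close>

section \<open>Rooted trees\<close>

datatype 'a rtree = Node (root_of: 'a) (children: "'a rtree list")

primrec nverts :: "'a rtree \<Rightarrow> nat" where
  "nverts (Node x ts) = Suc (sum_list (map nverts ts))"

text \<open>
  Rooted trees occur as the part of a tree on one side of an edge, so the root has one further
  neighbour: a vertex is odd iff it has an even number of children, and \<open>2 * half_odd t + 1\<close>
  vertices are odd.
\<close>

primrec half_odd :: "'a rtree \<Rightarrow> nat" where
  "half_odd (Node x ts) = sum_list (map half_odd ts) + length ts div 2"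

primrec sum_nverts :: "'a rtree \<Rightarrow> nat" where
  "sum_nverts (Node x ts) = Suc (sum_list (map nverts ts)) + sum_list (map sum_nverts ts)"

primrec n_large :: "nat \<Rightarrow> 'a rtree \<Rightarrow> nat" where
  "n_large m (Node x ts) =
     (if m \<le> Suc (sum_list (map nverts ts)) then 1 else 0) + sum_list (map (n_large m) ts)"

section \<open>Upper bound for the sum of the orders of rooted subtrees\<close>

lemma half_odd_le_forest:
  assumes "\<forall>t\<in>set ts. 2 * half_odd t + 1 \<le> nverts t"
  shows "2 * sum_list (map half_odd ts) + length ts \<le> sum_list (map nverts ts)"
  using assms by (induction ts) auto

lemma half_odd_le: "2 * half_odd t + 1 \<le> nverts t"
proof (induction t)
  case (Node x ts)
  then show ?case using half_odd_le_forest[of ts] by simp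
qed

lemma nverts_pos: "0 < nverts t"
  using half_odd_le[of t] by linarith

lemma nverts_neq_0: "nverts t \<noteq> 0"
  using nverts_pos by simp

text \<open>Induction step for adding a tree with data \<open>d\<close>, \<open>j\<close>,
  \<open>s\<close> to a forest with data \<open>D\<close>, \<open>J\<close>, \<open>S\<close>, where
  \<open>\<delta>\<close> is the parity of the number of trees in the forest. The cross term
  \<open>S * s\<close> is at least \<open>(2 * J + \<delta>) * (2 * j + 1)\<close>, and this pays
  for the growth of the square.\<close>

lemma sum_nverts_step:
  fixes D d J j S s \<delta> :: nat
  assumes "2 * D + 2 * J\<^sup>2 \<le> S * (S + 1)" "2 * d + 2 * j\<^sup>2 \<le> s * (s + 1)"
    and "2 * J + \<delta> \<le> S" "2 * j + 1 \<le> s" "\<delta> \<le> 1"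
  shows "2 * (D + d) + 2 * (J + j + \<delta>)\<^sup>2 \<le> (S + s) * (S + s + 1)"
    and "2 * (D + d) + 2 * (J + j + \<delta>)\<^sup>2 = (S + s) * (S + s + 1) \<Longrightarrow>
           2 * D + 2 * J\<^sup>2 = S * (S + 1) \<and> 2 * d + 2 * j\<^sup>2 = s * (s + 1) \<and> 
           S * s = (2 * J + \<delta>) * (2 * j + 1) \<and> J * j = 0 \<and> (\<delta> = 0 \<longrightarrow> J = 0)"
proof -
  have m: "(2 * J + \<delta>) * (2 * j + 1) \<le> S * s" using assms by (intro mult_le_mono) auto
  have d: "\<delta> = 0 \<or> \<delta> = 1" using assms by auto
  have e: "(S + s) * (S + s + 1) = S * (S + 1) + s * (s + 1) + 2 * (S * s)"
    by (simp add: algebra_simps)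
  \<comment> \<open>The term multiplied by 2 is the surplus of the estimate; its vanishing yields
    \<open>J * j = 0\<close> and, for \<open>\<delta> = 0\<close>, also
    \<open>J = 0\<close>.\<close>
  have J: "2 * (J + j + \<delta>)\<^sup>2 + (2 * (J * j) + (if \<delta> = 0 then 2 * J else 0)) * 2
      = 2 * J\<^sup>2 + 2 * j\<^sup>2 + 2 * ((2 * J + \<delta>) * (2 * j + 1))"
    using d
  proof
    assume "\<delta> = 0"
    then show ?thesis by (simp add: power2_sum distrib_left)
  next
    assume "\<delta> = 1"
    then show ?thesis by (simp add: power2_eq_square distrib_left distrib_right)
  qed
  \<comment> \<open>Linear core of both claims, with every product and square replaced by a
    variable.\<close>
  have key: "2 * (D + d) + 2 * K \<le> A \<and> (2 * (D + d) + 2 * K = A \<longrightarrow>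
      X = 0 \<and> P = Q \<and> 2 * D + 2 * J' = B \<and> 2 * d + 2 * j' = C)"
    if "Q \<le> P" "A = B + C + 2 * P" "2 * K + X * 2 = 2 * J' + 2 * j' + 2 * Q"
      "2 * D + 2 * J' \<le> B" "2 * d + 2 * j' \<le> C" for A B C K P Q X J' j' :: nat
    using that by auto
  note k = key[OF m e J assms(1,2)]
  show "2 * (D + d) + 2 * (J + j + \<delta>)\<^sup>2 \<le> (S + s) * (S + s + 1)"
    using k by blast
  assume "2 * (D + d) + 2 * (J + j + \<delta>)\<^sup>2 = (S + s) * (S + s + 1)"
  with k have "2 * (J * j) + (if \<delta> = 0 then 2 * J else 0) = 0 \<and>
      S * s = (2 * J + \<delta>) * (2 * j + 1) \<and> 2 * D + 2 * J\<^sup>2 = S * (S + 1)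
        \<and> 2 * d + 2 * j\<^sup>2 = s * (s + 1)"
    by blast
  moreover from this have "J * j = 0 \<and> (\<delta> = 0 \<longrightarrow> J = 0)" by (auto split: if_splits)
  ultimately show "2 * D + 2 * J\<^sup>2 = S * (S + 1) \<and> 2 * d + 2 * j\<^sup>2 = s * (s + 1) \<and>
           S * s = (2 * J + \<delta>) * (2 * j + 1) \<and> J * j = 0 \<and> (\<delta> = 0 \<longrightarrow> J = 0)"
    by blast
qed

lemma length_Suc_div_2: "Suc n div 2 = n div 2 + n mod 2" for n :: nat
  by presburger

lemma half_odd_le_forest':
  "2 * (sum_list (map half_odd ts) + length ts div 2) + length ts mod 2 \<le> sum_list (map nverts ts)"
proof -
  have "2 * (X + n div 2) + n mod 2 = 2 * X + n" for X n :: nat by simp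
  then show ?thesis using half_odd_le_forest[OF ballI[OF half_odd_le], of ts] by (simp only:)
qed

lemma mod_2_le_1: "n mod 2 \<le> 1" for n :: nat
  by presburger

lemma forest_Cons_simps:
  "sum_list (map sum_nverts (t # ts)) = sum_list (map sum_nverts ts) + sum_nverts t"
  "sum_list (map half_odd (t # ts)) + length (t # ts) div 2 =
    sum_list (map half_odd ts) + length ts div 2 + half_odd t + length ts mod 2"
  "sum_list (map nverts (t # ts)) = sum_list (map nverts ts) + nverts t"
  by (simp_all add: length_Suc_div_2)

lemma sum_nverts_forest_le:
  assumes "\<forall>t\<in>set ts. 2 * sum_nverts t + 2 * (half_odd t)\<^sup>2 \<le> nverts t * (nverts t + 1)"
  shows "2 * sum_list (map sum_nverts ts) + 2 * (sum_list (map half_odd ts) + length ts div 2)\<^sup>2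
    \<le> sum_list (map nverts ts) * (sum_list (map nverts ts) + 1)"
  using assms
proof (induction ts)
  case (Cons t ts)
  show ?case
    unfolding forest_Cons_simps
    by (rule sum_nverts_step(1)) (use Cons half_odd_le_forest'[of ts] half_odd_le[of t] in auto)
qed simp

text \<open>Equality must hold at every step of the induction. A third tree would join two others,
  an even number, which forces \<open>J = 0\<close>; but two trees already contribute 1 to
  \<open>J\<close>.\<close>

lemma sum_nverts_forest_eq:
  assumes "\<forall>t\<in>set ts. 2 * sum_nverts t + 2 * (half_odd t)\<^sup>2 \<le> nverts t * (nverts t + 1)"
    and "2 * sum_list (map sum_nverts ts) + 2 * (sum_list (map half_odd ts) + length ts div 2)\<^sup>2
    = sum_list (map nverts ts) * (sum_list (map nverts ts) + 1)"
  shows "length ts \<le> 2 \<and>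
    (\<forall>t\<in>set ts. 2 * sum_nverts t + 2 * (half_odd t)\<^sup>2 = nverts t * (nverts t + 1)) \<and>
    (\<forall>t u. ts = [t, u] \<longrightarrow> nverts t = 2 * half_odd t + 1 \<and> nverts u = 2 * half_odd u + 1 \<and>
       half_odd t * half_odd u = 0)"
  using assms
proof (induction ts)
  case (Cons t ts)
  let ?J = "sum_list (map half_odd ts) + length ts div 2" and ?S = "sum_list (map nverts ts)"
  have *: "2 * sum_list (map sum_nverts ts) + 2 * ?J\<^sup>2 = ?S * (?S + 1)"
    "2 * sum_nverts t + 2 * (half_odd t)\<^sup>2 = nverts t * (nverts t + 1)"
    "?S * nverts t = (2 * ?J + length ts mod 2) * (2 * half_odd t + 1)" "?J * half_odd t = 0"
    "length ts mod 2 = 0 \<longrightarrow> ?J = 0"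
  proof -
    have "\<forall>t\<in>set ts. 2 * sum_nverts t + 2 * (half_odd t)\<^sup>2 \<le> nverts t * (nverts t + 1)"
      "2 * sum_nverts t + 2 * (half_odd t)\<^sup>2 \<le> nverts t * (nverts t + 1)"
      using Cons.prems(1) by simp_all
    note sum_nverts_step(2)[OF sum_nverts_forest_le[OF this(1)] this(2) half_odd_le_forest'
        half_odd_le mod_2_le_1 Cons.prems(2)[unfolded forest_Cons_simps]]
    then show "2 * sum_list (map sum_nverts ts) + 2 * ?J\<^sup>2 = ?S * (?S + 1)"
      "2 * sum_nverts t + 2 * (half_odd t)\<^sup>2 = nverts t * (nverts t + 1)"
      "?S * nverts t = (2 * ?J + length ts mod 2) * (2 * half_odd t + 1)" "?J * half_odd t = 0"
      "length ts mod 2 = 0 \<longrightarrow> ?J = 0"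
      by - (elim conjE, assumption)+
  qed
  have "\<forall>t\<in>set ts. 2 * sum_nverts t + 2 * (half_odd t)\<^sup>2 \<le> nverts t * (nverts t + 1)"
    using Cons.prems(1) by simp
  note IH = Cons.IH[OF this *(1)]
  have "length ts \<noteq> 2" using *(5) by auto
  then have l: "length ts \<le> 1" using IH by linarith
  moreover have "nverts t = 2 * half_odd t + 1 \<and> nverts u = 2 * half_odd u + 1 \<and>
       half_odd t * half_odd u = 0" if "ts = [u]" for u
  proof -
    have p: "nverts u * nverts t = (2 * half_odd u + 1) * (2 * half_odd t + 1)" using *(3) that
      by simp
    \<comment> \<open>The products of the orders and of their lower bounds agree, so each order
      equals its lower bound.\<close>
    have "\<not> 2 * half_odd u + 1 < nverts u"
    proof
      assume "2 * half_odd u + 1 < nverts u"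
      then have "(2 * half_odd u + 1) * (2 * half_odd t + 1) < nverts u * (2 * half_odd t + 1)"
        by (simp only: mult_less_cancel2) simp
      also have "\<dots> \<le> nverts u * nverts t" using half_odd_le[of t] by (intro mult_le_mono) auto
      finally show False using p by simp
    qed
    then have u: "nverts u = 2 * half_odd u + 1" using half_odd_le[of u] by linarith
    then have "nverts t = 2 * half_odd t + 1" using p
      by (metis Suc_eq_plus1 mult_cancel1 nat.distinct(1))
    then show ?thesis using u *(4) that by auto
  qed
  ultimately show ?case using *(2) IH unfolding list.set
    by (simp only: list.inject ball_simps) force
qed simp

text \<open>The root adds its own order and leaves the squared term of the forest unchanged, so the
  forest bound for \<open>S\<close> becomes the tree bound for \<open>S + 1\<close>.\<close>

lemma sum_nverts_le: "2 * sum_nverts t + 2 * (half_odd t)\<^sup>2 \<le> nverts t * (nverts t + 1)"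
proof (induction t)
  case (Node x ts)
  then show ?case using sum_nverts_forest_le[of ts] by (simp add: algebra_simps)
qed

text \<open>The extremal rooted trees. The side condition of \<open>fork\<close> says that every
  vertex of \<open>t\<close> is odd, the edge above its root included. Forks preserve this and a
  stem destroys it for good, so all forks lie below all stems. \<open>fork'\<close> accounts for the
  order of the children.\<close>

inductive caterpillar :: "'a rtree \<Rightarrow> bool" where
  leaf: "caterpillar (Node x [])"
| stem: "caterpillar t \<Longrightarrow> caterpillar (Node x [t])"
| fork: "caterpillar t \<Longrightarrow> nverts t = 2 * half_odd t + 1 \<Longrightarrow> caterpillar (Node x [Node y [], t])"
| fork': "caterpillar t \<Longrightarrow> nverts t = 2 * half_odd t + 1 \<Longrightarrow> caterpillar (Node x [t, Node y []])"

text \<open>Equality passes to the children. Of two children, one has \<open>half_odd\<close> 0 and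
  order \<open>2 * 0 + 1\<close>, hence is a pendent vertex.\<close>

lemma caterpillar_if_sum_nverts_eq:
  "2 * sum_nverts t + 2 * (half_odd t)\<^sup>2 = nverts t * (nverts t + 1) \<Longrightarrow> caterpillar t"
proof (induction t)
  case (Node x ts)
  have f: "length ts \<le> 2 \<and>
    (\<forall>t\<in>set ts. 2 * sum_nverts t + 2 * (half_odd t)\<^sup>2 = nverts t * (nverts t + 1)) \<and>
    (\<forall>t u. ts = [t, u] \<longrightarrow> nverts t = 2 * half_odd t + 1 \<and> nverts u = 2 * half_odd u + 1 \<and>
       half_odd t * half_odd u = 0)"
    by (rule sum_nverts_forest_eq[OF ballI[OF sum_nverts_le]])
      (use Node.prems in \<open>simp add: algebra_simps\<close>)
  then have c: "\<forall>t\<in>set ts. caterpillar t" using Node.IH by auto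
  have leaf: "\<exists>y. t = Node y []" if "nverts t = 1" for t :: "'a rtree"
  proof (cases t)
    case (Node y us)
    then show ?thesis using that nverts_pos[of "hd us"] by (cases us) auto
  qed
  consider "ts = []" | t where "ts = [t]" | t u where "ts = [t, u]"
    using f by (metis One_nat_def Suc_1 le_Suc_eq le_zero_eq length_0_conv length_Suc_conv)
  then show ?case
  proof cases
    case 3
    with f have tu: "nverts t = 2 * half_odd t + 1" "nverts u = 2 * half_odd u + 1"
      "half_odd t = 0 \<or> half_odd u = 0" by auto
    then show ?thesis
    proof (elim disjE)
      assume "half_odd t = 0"
      then show ?thesis using leaf[of t] tu c 3 by (auto intro: caterpillar.intros)
    next
      assume "half_odd u = 0"
      then show ?thesis using leaf[of u] tu c 3 by (auto intro: caterpillar.intros)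
    qed
  qed (use c in \<open>auto intro: caterpillar.intros\<close>)
qed

lemma caterpillar_sum_nverts:
  "caterpillar t \<Longrightarrow> 2 * sum_nverts t + 2 * (half_odd t)\<^sup>2 = nverts t * (nverts t + 1)"
  by (induction t rule: caterpillar.induct) (auto simp: algebra_simps power2_eq_square)

section \<open>Counting rooted subtrees of order at least \<open>m\<close>\<close>

lemma n_large_0: "nverts t < m \<Longrightarrow> n_large m t = 0"
proof (induction t)
  case (Node x ts)
  have "nverts t < m" if "t \<in> set ts" for t
    using that Node.prems member_le_sum_list[of "nverts t" "map nverts ts"] by auto
  then show ?case using Node by (auto intro!: sum_list_0)
qed

text \<open>Every tree leaves room for at least 1: a small one by \<open>half_odd_le\<close>, a
  large one by \<open>\<tau>\<close>. One large tree thus improves the total by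
  \<open>\<tau> - 1\<close>.\<close>

lemma n_large_forest:
  assumes "\<forall>t\<in>set ts. m \<le> nverts t \<longrightarrow> n_large m t + half_odd t + \<tau> \<le> nverts t" "1 \<le> \<tau>"
  shows "if \<exists>t\<in>set ts. m \<le> nverts t
    then sum_list (map (n_large m) ts) + sum_list (map half_odd ts) + length ts + \<tau>
      \<le> sum_list (map nverts ts) + 1
    else sum_list (map (n_large m) ts) + sum_list (map half_odd ts) + length ts
      \<le> sum_list (map nverts ts)"
  using assms
proof (induction ts)
  case (Cons t ts)
  then show ?case using half_odd_le[of t] n_large_0[of t m]
    by (cases "m \<le> nverts t") (auto split: if_splits)
qed simp

text \<open>At a root with a large child, \<open>length ts div 2 + 1 <= length ts\<close> pays for
  counting the root. Otherwise only the root is counted, and halving \<open>2 * J <= S\<close> and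
  \<open>m <= S + 1\<close> gives the claim after rounding, \<open>S\<close> being the order of the
  forest of children.\<close>

lemma n_large_half_odd_le:
  "2 \<le> m \<Longrightarrow> m \<le> nverts t \<Longrightarrow> n_large m t + half_odd t + m div 2 \<le> nverts t"
proof (induction t)
  case (Node x ts)
  have "1 \<le> m div 2" using Node.prems(1) by linarith
  then have f: "\<exists>t\<in>set ts. m \<le> nverts t \<Longrightarrow> sum_list (map (n_large m) ts) +
      sum_list (map half_odd ts) + length ts + m div 2 \<le> sum_list (map nverts ts) + 1"
    using n_large_forest[of ts m "m div 2"] Node by auto
  show ?case
  proof (cases "\<exists>t\<in>set ts. m \<le> nverts t")
    case True
    then have "1 \<le> length ts" by (cases ts) auto
    then have "length ts div 2 + 1 \<le> length ts" by linarith
    then show ?thesis using f[OF True] Node.prems by simp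
  next
    case False
    then have 0: "sum_list (map (n_large m) ts) = 0" using n_large_0 by (auto simp: not_le)
    have "J + k \<le> S" if "2 * J + r \<le> S" "2 * k \<le> m" "m \<le> Suc S" for J k r S m :: nat
      using that by linarith
    note this[OF half_odd_le_forest' _ Node.prems(2)[unfolded nverts.simps], of "m div 2"]
    then show ?thesis unfolding nverts.simps n_large.simps half_odd.simps 0 using Node.prems by simp
  qed
qed

text \<open>A lowest subtree of order at least \<open>m\<close> has at least \<open>m - 1\<close>
  vertices besides its root, and none of them is the root of a counted subtree.\<close>

lemma n_large_le: "1 \<le> m \<Longrightarrow> m \<le> nverts t \<Longrightarrow> n_large m t + (m - 1) \<le> nverts t"
proof (induction t)
  case (Node x ts)
  have f: "sum_list (map (n_large m) us) + (if \<exists>t\<in>set us. m \<le> nverts t then m - 1 else 0)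
      \<le> sum_list (map nverts us)" if "set us \<subseteq> set ts" for us
    using that
  proof (induction us)
    case (Cons u us)
    then have "m \<le> nverts u \<Longrightarrow> n_large m u + (m - 1) \<le> nverts u" using Node by auto
    then show ?case using Cons n_large_0[of u m] by (cases "m \<le> nverts u") (auto split: if_splits)
  qed simp
  show ?case
  proof (cases "\<exists>t\<in>set ts. m \<le> nverts t")
    case True
    then show ?thesis using f[of ts] Node by auto
  next
    case False
    then have 0: "sum_list (map (n_large m) ts) = 0" using n_large_0 by (auto simp: not_le)
    show ?thesis unfolding nverts.simps n_large.simps 0 using Node.prems by simp
  qed
qed

section \<open>Rooted trees as graphs and their rerootings\<close>

primrec labels :: "'a rtree \<Rightarrow> 'a list" where
  "labels (Node x ts) = x # concat (map labels ts)"

primrec child_edges :: "'a rtree \<Rightarrow> ('a \<times> 'a rtree) list" where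
  "child_edges (Node x ts) = concat (map (\<lambda>t. (x, t) # child_edges t) ts)"

definition tree_arcs :: "'a rtree \<Rightarrow> ('a \<times> 'a) set" where
  "tree_arcs t = (\<lambda>(x, s). (x, root_of s)) ` set (child_edges t)"

definition tree_graph :: "'a rtree \<Rightarrow> 'a pair_pre_digraph" where
  "tree_graph t = \<lparr>pverts = set (labels t), parcs = tree_arcs t \<union> (tree_arcs t)\<inverse>\<rparr>"

text \<open>Encodes an edge of a tree together with its two sides: it joins the two roots.\<close>

definition attach :: "'a rtree \<Rightarrow> 'a rtree \<Rightarrow> 'a rtree" where
  "attach u w = Node (root_of w) (u # children w)"

text \<open>Equality of the unrooted labelled trees. The multiset of labels transfers order and
  distinctness, which the graph alone does not determine.\<close>

definition rerooting :: "'a rtree \<Rightarrow> 'a rtree \<Rightarrow> bool" (infix "\<approx>" 50) where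
  "t \<approx> t' \<longleftrightarrow> tree_graph t = tree_graph t' \<and> mset (labels t) = mset (labels t')"

lemma rerooting_refl [simp]: "t \<approx> t"
  and rerooting_sym: "t \<approx> t' \<Longrightarrow> t' \<approx> t"
  and rerooting_trans [trans]: "t \<approx> t' \<Longrightarrow> t' \<approx> t'' \<Longrightarrow> t \<approx> t''"
  by (simp_all add: rerooting_def)

lemma rerooting_distinct: "t \<approx> t' \<Longrightarrow> distinct (labels t) \<longleftrightarrow> distinct (labels t')"
  unfolding rerooting_def by (blast dest: mset_eq_imp_distinct_iff)

lemma length_labels [simp]: "length (labels t) = nverts t"
  by (induction t) (simp add: length_concat o_def cong: map_cong)

lemma rerooting_nverts: "t \<approx> t' \<Longrightarrow> nverts t = nverts t'"
  by (metis length_labels mset_eq_length rerooting_def)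

lemma root_in_labels [simp]: "root_of t \<in> set (labels t)"
  by (cases t) simp

lemma tree_arcs_Node:
  "tree_arcs (Node x ts) = (\<Union>t\<in>set ts. insert (x, root_of t) (tree_arcs t))"
  by (auto simp: tree_arcs_def)

lemma tree_arcs_attach:
  "tree_arcs (attach u w) = insert (root_of w, root_of u) (tree_arcs u \<union> tree_arcs w)"
  by (cases w) (auto simp: attach_def tree_arcs_Node)

lemma labels_attach: "mset (labels (attach u w)) = mset (labels u) + mset (labels w)"
  by (cases w) (auto simp: attach_def)

lemma set_labels_attach: "set (labels (attach u w)) = set (labels u) \<union> set (labels w)"
  by (metis labels_attach set_mset_mset set_mset_union)

lemma distinct_labels_attach:
  "distinct (labels (attach u w)) \<longleftrightarrow>
    distinct (labels u) \<and> distinct (labels w) \<and> set (labels u) \<inter> set (labels w) = {}"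
  by (cases w) (auto simp: attach_def)

lemma attach_commute: "attach u w \<approx> attach w u"
  by (auto simp: rerooting_def tree_graph_def labels_attach set_labels_attach tree_arcs_attach)

lemma rerooting_mset:
  "mset ts = mset us \<Longrightarrow> Node x ts \<approx> Node x us"
  by (auto simp: rerooting_def tree_graph_def tree_arcs_Node mset_concat
      simp flip: sum_mset_sum_list dest: mset_eq_setD)

text \<open>\<open>r\<close> stands for everything above \<open>t\<close>. A step down into a child
  moves the parent and its other children into \<open>r\<close>, so \<open>r\<close> has to be
  arbitrary in the induction.\<close>

lemma child_edge_attach:
  "(x, s) \<in> set (child_edges t) \<Longrightarrow> \<exists>w. root_of w = x \<and> attach s w \<approx> attach t r"
proof (induction t arbitrary: r)
  case (Node y ts)
  from Node.prems obtain t where t: "t \<in> set ts" "(x, s) = (y, t) \<or> (x, s) \<in> set (child_edges t)"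
    by auto
  let ?w = "Node y (r # remove1 t ts)"
  have "attach t ?w \<approx> Node y (r # ts)"
    unfolding attach_def using t(1) by (auto intro!: rerooting_mset)
  also have "Node y (r # ts) \<approx> attach (Node y ts) r"
    using attach_commute[of r "Node y ts"] by (simp add: attach_def)
  finally have a: "attach t ?w \<approx> attach (Node y ts) r" .
  show ?case
  proof (cases "(x, s) = (y, t)")
    case True
    then show ?thesis using a by (intro exI[of _ ?w]) auto
  next
    case False
    then show ?thesis using Node.IH[OF t(1), of ?w] t(2) a rerooting_trans by blast
  qed
qed

text \<open>Nothing lies above the root, so the first step down is done separately;
  \<open>child_edge_attach\<close> does the rest.\<close>

lemma child_edge_rerooting:
  assumes "(x, s) \<in> set (child_edges t)"
  obtains w where "root_of w = x" "attach s w \<approx> t"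
proof (cases t)
  case (Node y ts)
  then obtain u where u: "u \<in> set ts" "(x, s) = (y, u) \<or> (x, s) \<in> set (child_edges u)"
    using assms by auto
  let ?w = "Node y (remove1 u ts)"
  have a: "attach u ?w \<approx> t"
    unfolding attach_def Node using u(1) by (auto intro!: rerooting_mset)
  show ?thesis
  proof (cases "(x, s) = (y, u)")
    case True
    then show ?thesis using a by (intro that[of ?w]) auto
  next
    case False
    then show ?thesis using child_edge_attach[of x s u ?w] u(2) a rerooting_trans that by blast
  qed
qed

lemma label_child_edge:
  "y \<in> set (labels t) \<Longrightarrow> y = root_of t \<or> (\<exists>(x, s) \<in> set (child_edges t). y = root_of s)"
proof (induction t)
  case (Node x ts)
  then show ?case by fastforce
qed

lemma exists_rerooting:
  assumes "x \<in> set (labels t)"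
  obtains t' where "t' \<approx> t" "root_of t' = x"
proof (cases "x = root_of t")
  case True
  then show ?thesis using that[of t] by simp
next
  case False
  then obtain p s where s: "(p, s) \<in> set (child_edges t)" "x = root_of s"
    using label_child_edge[OF assms] by auto
  then obtain w where "attach s w \<approx> t" using child_edge_rerooting by metis
  then have "attach w s \<approx> t" using attach_commute rerooting_trans by blast
  then show ?thesis using that s(2) by (simp add: attach_def)
qed

lemma tree_arcs_labels: "(x, y) \<in> tree_arcs t \<Longrightarrow> x \<in> set (labels t) \<and> y \<in> set (labels t)"
proof (induction t)
  case (Node z ts)
  then show ?case by (fastforce simp: tree_arcs_Node)
qed

lemma tree_arc_attach:
  assumes "(x, y) \<in> tree_arcs t"
  obtains u w where "root_of u = y" "root_of w = x" "attach u w \<approx> t"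
proof -
  from assms obtain s where "(x, s) \<in> set (child_edges t)" "y = root_of s"
    by (auto simp: tree_arcs_def)
  then show ?thesis using child_edge_rerooting that by metis
qed

lemma tree_graph_simps [simp]:
  "pverts (tree_graph t) = set (labels t)"
  "parcs (tree_graph t) = tree_arcs t \<union> (tree_arcs t)\<inverse>"
  by (simp_all add: tree_graph_def)

lemma rerooting_graph: "t \<approx> t' \<Longrightarrow> tree_graph t = tree_graph t'"
  by (simp add: rerooting_def)

text \<open>Reduces statements about an arbitrary arc, in either direction, to the arc between the
  roots of two joined trees.\<close>

lemma graph_arc_attach:
  assumes "(x, y) \<in> parcs (tree_graph t)"
  obtains u w where "root_of u = x" "root_of w = y" "attach u w \<approx> t"
proof -
  consider "(x, y) \<in> tree_arcs t" | "(y, x) \<in> tree_arcs t" using assms by auto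
  then show ?thesis
  proof cases
    case 1
    then obtain u w where "root_of u = y" "root_of w = x" "attach u w \<approx> t" using tree_arc_attach
      by metis
    then show ?thesis using that[of w u] attach_commute rerooting_trans by blast
  next
    case 2
    then obtain u w where "root_of u = x" "root_of w = y" "attach u w \<approx> t" using tree_arc_attach
      by metis
    then show ?thesis using that by blast
  qed
qed

section \<open>Tree graphs are connected and acyclic\<close>

lemma finite_tree_arcs [simp]: "finite (tree_arcs t)"
  by (simp add: tree_arcs_def)

lemma pair_graph_tree_graph:
  assumes "distinct (labels t)"
  shows "pair_graph (tree_graph t)"
proof unfold_locales
  fix e assume e: "e \<in> parcs (tree_graph t)"
  then show "fst e \<in> pverts (tree_graph t)" "snd e \<in> pverts (tree_graph t)"
    using tree_arcs_labels[of "fst e" "snd e" t] tree_arcs_labels[of "snd e" "fst e" t] by auto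
  obtain x y where xy: "e = (x, y)" by (cases e)
  obtain u w where "root_of u = x" "root_of w = y" "attach u w \<approx> t"
    using graph_arc_attach[of x y t] e xy by metis
  then show "fst e \<noteq> snd e"
    using assms distinct_labels_attach[of u w] rerooting_distinct root_in_labels xy
    by (metis disjoint_iff fst_conv snd_conv)
next
  show "symmetric (with_proj (tree_graph t))"
    by (auto simp: symmetric_def sym_def)
qed auto

lemma graph_arc_attach_leaving:
  assumes "distinct (labels (attach u w))" "(x, y) \<in> parcs (tree_graph (attach u w))"
    and "x \<in> set (labels u)" "y \<notin> set (labels u)"
  shows "x = root_of u \<and> y = root_of w"
  using assms tree_arcs_labels[of x y u] tree_arcs_labels[of y x u]
    tree_arcs_labels[of x y w] tree_arcs_labels[of y x w]
  by (auto simp: tree_arcs_attach distinct_labels_attach)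

text \<open>The joining edge is a bridge; the walk is cut at its first exit from
  \<open>u\<close>.\<close>

lemma awalk_attach_leaving:
  fixes u w
  defines "G \<equiv> with_proj (tree_graph (attach u w))"
  assumes "distinct (labels (attach u w))" "pre_digraph.awalk G x p y"
    and "x \<in> set (labels u)" "y \<notin> set (labels u)"
  shows "\<exists>p1 p2. p = p1 @ (root_of u, root_of w) # p2 \<and>
    pre_digraph.awalk G x p1 (root_of u) \<and> pre_digraph.awalk G (root_of w) p2 y"
proof -
  interpret pair_graph "tree_graph (attach u w)"
    by (rule pair_graph_tree_graph) fact
  show ?thesis
    using assms(3,4) unfolding G_def
  proof (induction p arbitrary: x)
    case Nil
    then show ?case using assms(5) by (auto simp: awalk_Nil_iff)
  next
    case (Cons e p)
    then obtain z where e: "e = (x, z)" "(x, z) \<in> parcs (tree_graph (attach u w))" "awalk z p y"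
      by (cases e) (auto simp: awalk_Cons_iff)
    show ?case
    proof (cases "z \<in> set (labels u)")
      case True
      then obtain p1 p2 where "p = p1 @ (root_of u, root_of w) # p2" "awalk z p1 (root_of u)"
        "awalk (root_of w) p2 y"
        using Cons.IH[OF e(3)] by blast
      then show ?thesis
        using e by (intro exI[of _ "e # p1"] exI[of _ p2]) (auto simp: awalk_Cons_iff)
    next
      case False
      then have "x = root_of u" "z = root_of w"
        using graph_arc_attach_leaving[OF assms(2) e(2) Cons.prems(2)] by auto
      then show ?thesis
        using e Cons.prems(2)
          by (intro exI[of _ "[]"] exI[of _ p]) (auto simp: awalk_Nil_iff set_labels_attach)
    qed
  qed
qed

lemma no_long_cycle_tree_graph:
  assumes "distinct (labels t)" "pre_digraph.cycle (with_proj (tree_graph t)) p"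
  shows "length p < 3"
proof -
  interpret pair_graph "tree_graph t"
    by (rule pair_graph_tree_graph) fact
  from assms(2) obtain x where x: "awalk x p x" "distinct (tl (awalk_verts x p))" "p \<noteq> []"
    by (auto simp: cycle_def)
  then obtain y q where p: "p = (x, y) # q" "(x, y) \<in> parcs (tree_graph t)" "awalk y q x"
    "distinct (awalk_verts y q)"
    by (cases p) (auto simp: awalk_Cons_iff)
  obtain u w where uw: "root_of u = x" "root_of w = y" "attach u w \<approx> t"
    using graph_arc_attach[OF p(2)] by metis
  have wu: "attach w u \<approx> t" using uw(3) attach_commute rerooting_trans by blast
  note g = rerooting_graph[OF wu]
  have d: "distinct (labels (attach w u))" using wu rerooting_distinct assms(1) by blast
  have "x \<notin> set (labels w)"
    using d uw root_in_labels[of u] by (auto simp: distinct_labels_attach)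
  \<comment> \<open>The rest of the cycle leads from \<open>y\<close> back to \<open>x\<close> and
    must use the same bridge in reverse. As its vertices are distinct, the bridge is all of
    it.\<close>
  then obtain q1 q2 where q: "q = q1 @ (y, x) # q2" "awalk y q1 y" "awalk x q2 x"
    using awalk_attach_leaving[of w u y q x] d p(3) uw root_in_labels[of w] unfolding g by auto
  have "apath y q x" using p(3,4) by (simp add: apath_def)
  then have "apath y q1 y" "apath y ((y, x) # q2) x"
    using q awlast_of_awalk[OF q(2)] by (auto simp: apath_append_iff awalk_def)
  then have "q1 = []" "apath x q2 x"
    using apath_nonempty_ends by (auto simp: apath_Cons_iff)
  then have "q2 = []" using apath_nonempty_ends by blast
  then show ?thesis using p(1) q(1) \<open>q1 = []\<close> by simp
qed

lemma root_reaches: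
  "distinct (labels t) \<Longrightarrow> x \<in> set (labels t) \<Longrightarrow> (root_of t, x) \<in> (tree_arcs t)\<^sup>*"
proof (induction t)
  case (Node y ts)
  show ?case
  proof (cases "x = y")
    case False
    then obtain t where t: "t \<in> set ts" "x \<in> set (labels t)" using Node.prems by auto
    then have "distinct (labels t)" using Node.prems by (auto simp: distinct_concat_iff)
    then have "(root_of t, x) \<in> (tree_arcs t)\<^sup>*" using Node t by auto
    moreover have "tree_arcs t \<subseteq> tree_arcs (Node y ts)" "(y, root_of t) \<in> tree_arcs (Node y ts)"
      using t by (auto simp: tree_arcs_Node)
    ultimately show ?thesis
      by (metis converse_rtrancl_into_rtrancl rtree.sel(1) rtrancl_mono subsetD)
  qed simp
qed

lemma connected_tree_graph:
  assumes "distinct (labels t)"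
  shows "strongly_connected (with_proj (tree_graph t))"
proof -
  interpret pair_graph "tree_graph t"
    by (rule pair_graph_tree_graph) fact
  have r: "root_of t \<rightarrow>\<^sup>*\<^bsub>with_proj (tree_graph t)\<^esub> x" if "x \<in> set (labels t)" for x
  proof -
    have "(root_of t, x) \<in> (parcs (tree_graph t))\<^sup>*"
      using root_reaches[OF assms that] rtrancl_mono[of "tree_arcs t" "parcs (tree_graph t)"]
        by auto
    then show ?thesis by (simp add: reachable_conv')
  qed
  show ?thesis
  proof (rule strongly_connectedI)
    show "verts (with_proj (tree_graph t)) \<noteq> {}" using root_in_labels[of t]
      by (metis empty_iff tree_graph_simps(1) with_proj_simps(1))
  next
    fix x y assume "x \<in> verts (with_proj (tree_graph t))" "y \<in> verts (with_proj (tree_graph t))"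
    then show "x \<rightarrow>\<^sup>*\<^bsub>with_proj (tree_graph t)\<^esub> y"
      using r symmetric_reachable'[OF r[of x]] reachable_trans by auto
  qed
qed

lemma undirected_tree_tree_graph:
  assumes "distinct (labels t)"
  shows "undirected_tree (tree_graph t)"
proof -
  interpret pair_graph "tree_graph t"
    by (rule pair_graph_tree_graph) fact
  have "(parcs (tree_graph t))\<^sup>s = parcs (tree_graph t)" by (auto simp: symcl_def)
  then have "connected (with_proj (tree_graph t))"
    using connected_tree_graph[OF assms]
    by (simp add: connected_conv strongly_connected_def reachable_def)
  then show ?thesis
    unfolding undirected_tree_def
    using pair_graph_tree_graph[OF assms] no_long_cycle_tree_graph[OF assms]
    by (metis not_le)
qed

lemma gdist_attach:
  assumes "distinct (labels (attach u w))" "x \<in> set (labels u)"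
  shows "gdist (tree_graph (attach u w)) x (root_of u) < gdist (tree_graph (attach u w)) x
    (root_of w)"
proof -
  let ?G = "tree_graph (attach u w)"
  interpret pair_graph ?G
    by (rule pair_graph_tree_graph) fact
  have cost: "awalk_cost (\<lambda>_. 1) p = length p" for p :: "('a \<times> 'a) list"
    by (induction p) auto
  let ?d = "gdist ?G x (root_of u)"
  have gd: "gdist ?G x y = (INF p\<in>{p. awalk x p y}. ereal (real (length p)))" for y
    unfolding gdist_def \<mu>_def cost ..
  have "x \<rightarrow>\<^sup>*\<^bsub>with_proj ?G\<^esub> root_of u"
    using connected_tree_graph[OF assms(1)] assms(2)
    by (auto simp: strongly_connected_def set_labels_attach)
  then obtain p where "awalk x p (root_of u)" by (auto simp: reachable_awalk)
  then have "?d \<le> ereal (length p)" unfolding gd by (intro INF_lower) auto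
  moreover have "0 \<le> ?d" unfolding gd by (intro INF_greatest) auto
  \<comment> \<open>Finiteness is what makes \<open>?d < ?d + 1\<close> strict in
    \<open>ereal\<close>.\<close>
  ultimately have fin: "\<bar>?d\<bar> \<noteq> \<infinity>" by auto
  \<comment> \<open>A walk to the other root crosses the bridge, and its part before the crossing is
    a shorter walk to \<open>root_of u\<close>.\<close>
  have "?d + 1 \<le> gdist ?G x (root_of w)"
    unfolding gd[of "root_of w"]
  proof (rule INF_greatest, clarify)
    fix p assume p: "awalk x p (root_of w)"
    have "root_of w \<notin> set (labels u)"
      using assms(1) root_in_labels[of w] by (auto simp: distinct_labels_attach)
    then obtain p1 p2 where p12: "p = p1 @ (root_of u, root_of w) # p2" "awalk x p1 (root_of u)"
      using awalk_attach_leaving[OF assms(1)] p assms(2) by blast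
    have "?d \<le> ereal (length p1)" unfolding gd using p12 by (intro INF_lower) auto
    then have "?d + 1 \<le> ereal (length p1) + 1" by (rule add_right_mono)
    also have "\<dots> \<le> ereal (length p)" using p12(1) by simp
    finally show "?d + 1 \<le> ereal (real (length p))" .
  qed
  moreover have "?d < ?d + 1" using fin by (cases ?d) auto
  ultimately show ?thesis by (rule less_le_trans[rotated])
qed

lemma n_closer_attach:
  assumes "distinct (labels (attach u w))"
  shows "n_closer (tree_graph (attach u w)) (root_of u) (root_of w) = nverts u"
    and "n_closer (tree_graph (attach u w)) (root_of w) (root_of u) = nverts w"
proof -
  let ?G = "tree_graph (attach u w)"
  have d: "distinct (labels (attach w u))"
    using assms attach_commute rerooting_distinct by blast
  have g: "tree_graph (attach w u) = ?G"
    using attach_commute rerooting_graph by blast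
  have u: "gdist ?G x (root_of u) < gdist ?G x (root_of w)" if "x \<in> set (labels u)" for x
    using gdist_attach[OF assms that] .
  have w: "gdist ?G x (root_of w) < gdist ?G x (root_of u)" if "x \<in> set (labels w)" for x
    using gdist_attach[OF d that] unfolding g .
  have "{x \<in> pverts ?G. gdist ?G x (root_of u) < gdist ?G x (root_of w)} = set (labels u)"
    using u w by (fastforce simp: set_labels_attach)
  then show "n_closer ?G (root_of u) (root_of w) = nverts u"
    using assms distinct_card[of "labels u"] by (simp add: n_closer_def distinct_labels_attach)
  have "{x \<in> pverts ?G. gdist ?G x (root_of w) < gdist ?G x (root_of u)} = set (labels w)"
    using u w by (fastforce simp: set_labels_attach)
  then show "n_closer ?G (root_of w) (root_of u) = nverts w"
    using assms distinct_card[of "labels w"] by (simp add: n_closer_def distinct_labels_attach)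
qed

section \<open>Rooted representations of undirected trees\<close>

text \<open>Take a rooted tree of maximal order inside \<open>G\<close>. It spans \<open>G\<close>,
  since a missing neighbour could be attached as a leaf after rerooting, and acyclicity of
  \<open>G\<close> leaves no further arc.\<close>

lemma undirected_tree_obtains_rtree:
  fixes G :: "'a pair_pre_digraph"
  assumes "undirected_tree G"
  obtains t where "distinct (labels t)" "tree_graph t = G"
proof -
  interpret pair_graph G using assms by (simp add: undirected_tree_def)
  have sc: "strongly_connected (with_proj G)"
    using assms symmetric_connected_imp_strongly_connected sym_arcs
    by (auto simp: undirected_tree_def)
  define sub where
    "sub t \<longleftrightarrow> distinct (labels t) \<and> set (labels t) \<subseteq> pverts G \<and> parcs (tree_graph t) \<subseteq> parcs G" for t
  obtain r where "r \<in> pverts G" using sc by (auto simp: strongly_connected_def)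
  then have "sub (Node r [])" by (simp add: sub_def tree_arcs_Node)
  moreover have "nverts t < Suc (card (pverts G))" if "sub t" for t
    using that card_mono[OF pair_finite_verts, of "set (labels t)"] distinct_card[of "labels t"]
    by (simp add: sub_def)
  ultimately obtain t where t: "sub t" and max: "\<And>t'. sub t' \<Longrightarrow> nverts t' \<le> nverts t"
    using ex_has_greatest_nat[of sub "Node r []" nverts "Suc (card (pverts G))"] by blast
  have d: "distinct (labels t)" using t by (simp add: sub_def)
  have reach: "y \<in> set (labels t)" if "root_of t \<rightarrow>\<^sup>*\<^bsub>with_proj G\<^esub> y" for y
    using that
  proof (induction rule: reachable_induct)
    case (step a b)
    then have ab: "(a, b) \<in> parcs G" "a \<in> set (labels t)" by auto
    show "b \<in> set (labels t)"
    proof (rule ccontr)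
      assume b: "b \<notin> set (labels t)"
      obtain t' where t': "t' \<approx> t" "root_of t' = a" using exists_rerooting[OF ab(2)] .
      let ?t = "attach (Node b []) t'"
      have lab: "set (labels t') = set (labels t)" "parcs (tree_graph t') = parcs (tree_graph t)"
        using t'(1) by (simp_all only: rerooting_graph flip: tree_graph_simps(1))
      have "sub ?t"
        using t ab b t' lab rerooting_distinct[OF t'(1)] in_arcsD2[OF ab(1)] arcs_symmetric[OF
          ab(1)]
        by (auto simp: sub_def distinct_labels_attach set_labels_attach tree_arcs_attach
          tree_arcs_Node)
      then have "nverts ?t \<le> nverts t" by (rule max)
      moreover have "nverts ?t = Suc (nverts t)"
        using rerooting_nverts[OF t'(1)] by (cases t') (simp add: attach_def)
      ultimately show False by simp
    qed
  qed simp
  have r: "root_of t \<in> pverts G" using t root_in_labels[of t] by (auto simp: sub_def)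
  have verts: "set (labels t) = pverts G"
  proof
    show "set (labels t) \<subseteq> pverts G" using t by (simp add: sub_def)
    show "pverts G \<subseteq> set (labels t)"
      using sc r reach unfolding strongly_connected_def with_proj_simps by blast
  qed
  interpret T: pair_graph "tree_graph t" using pair_graph_tree_graph[OF d] .
  have "parcs G \<subseteq> parcs (tree_graph t)"
  proof (rule ccontr)
    assume "\<not> parcs G \<subseteq> parcs (tree_graph t)"
    then obtain x y where xy: "(x, y) \<in> parcs G" "(x, y) \<notin> parcs (tree_graph t)" by auto
    have "x \<rightarrow>\<^sup>*\<^bsub>with_proj (tree_graph t)\<^esub> y"
      using connected_tree_graph[OF d] xy verts wellformed'[OF xy(1)]
        by (auto simp: strongly_connected_def)
    then obtain p where p: "T.apath x p y" by (auto simp: T.reachable_apath)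
    have pG: "awalk x p y"
      using p t verts by (auto simp: T.apath_def T.awalk_def awalk_def sub_def)
    \<comment> \<open>The tree path from \<open>x\<close> to \<open>y\<close> has at least two arcs,
      as \<open>(x, y)\<close> is neither a loop nor a tree arc. Closing it by \<open>(y, x)\<close>
      gives a cycle of length at least 3.\<close>
    have "p \<noteq> []" using p no_loops'[OF xy(1)] by (auto simp: T.apath_Nil_iff)
    moreover have "p \<noteq> [e]" for e using p xy(2) by (cases e) (auto simp: T.apath_def T.awalk_def)
    ultimately have "2 \<le> length p" by (cases p rule: remdups_adj.cases) auto
    moreover have "cycle ((y, x) # p)"
      using pG p arcs_symmetric[OF xy(1)] unfolding cycle_def
      by (intro exI[of _ y]) (auto simp: awalk_Cons_iff T.apath_def)
    ultimately show False
      using assms unfolding undirected_tree_def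
        by (metis Suc_le_mono length_Cons numeral_2_eq_2 numeral_3_eq_3)
  qed
  then have "tree_graph t = G"
    using verts t by (intro pair_pre_digraph.equality) (auto simp: sub_def)
  then show ?thesis using that d by blast
qed

section \<open>Edges of a rooted tree and the Mostar index\<close>

lemma tl_labels: "map (\<lambda>(x, s). root_of s) (child_edges t) = tl (labels t)"
proof (induction t)
  case (Node x ts)
  have "map (\<lambda>(x, s). root_of s) ((x, t) # child_edges t) = labels t" if "t \<in> set ts" for t
    using Node[OF that] by (cases t) auto
  then show ?case by (auto simp: map_concat o_def intro!: arg_cong[where f = concat])
qed

lemma length_child_edges: "length (child_edges t) = nverts t - 1"
  using arg_cong[OF tl_labels, of length t] by simp

text \<open>Excludes that one edge arises in both orientations: the subtree orders would decrease
  strictly both ways.\<close>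

lemma child_edges_ordered:
  "(x, s) \<in> set (child_edges t) \<Longrightarrow>
    x = root_of t \<or> (\<exists>(p, r) \<in> set (child_edges t). root_of r = x \<and> nverts s < nverts r)"
proof (induction t)
  case (Node y ts)
  then obtain t where t: "t \<in> set ts" "(x, s) = (y, t) \<or> (x, s) \<in> set (child_edges t)" by auto
  show ?case
  proof (cases "(x, s) = (y, t)")
    case False
    have "nverts s < nverts t" if "(z, s) \<in> set (child_edges t)" for z s and t :: "'a rtree"
      using that
    proof (induction t)
      case (Node y ts)
      then obtain t where "t \<in> set ts" "s = t \<or> (z, s) \<in> set (child_edges t)" by auto
      then have "t \<in> set ts" "nverts s \<le> nverts t" using Node.IH by fastforce+
      then show ?case using member_le_sum_list[of "nverts t" "map nverts ts"] by auto
    qed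
    then show ?thesis using False t Node.IH[OF t(1)] by fastforce
  qed simp
qed

lemma inj_on_child_edges:
  assumes "distinct (labels t)"
  shows "inj_on (\<lambda>(x, s). {x, root_of s}) (set (child_edges t))" "distinct (child_edges t)"
proof -
  have d: "distinct (map (\<lambda>(x, s). root_of s) (child_edges t))"
    using assms distinct_tl by (simp add: tl_labels)
  then show "distinct (child_edges t)" by (simp add: distinct_map)
  have u: "(x, s) = (y, r)" if "(x, s) \<in> set (child_edges t)" "(y, r) \<in> set (child_edges t)"
    "root_of s = root_of r" for x s y r
    using d that inj_onD[of "\<lambda>(x, s). root_of s" "set (child_edges t)" "(x, s)" "(y, r)"]
    by (auto simp: distinct_map)
  have nr: "root_of s \<noteq> root_of t" if "(x, s) \<in> set (child_edges t)" for x s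
  proof -
    have "root_of s \<in> set (tl (labels t))"
      using that by (force simp flip: tl_labels)
    then show ?thesis using assms by (cases t) auto
  qed
  have lt: "nverts s < nverts r" if "(x, s) \<in> set (child_edges t)" "(y, r) \<in> set (child_edges t)"
    "x = root_of r" for x s y r
  proof -
    note xs = that
    have "x \<noteq> root_of t" using nr[OF xs(2)] xs(3) by simp
    then obtain p r' where r': "(p, r') \<in> set (child_edges t)" "root_of r' = x"
      "nverts s < nverts r'"
      using child_edges_ordered[OF xs(1)] by auto
    then have "r' = r" using u[OF r'(1) xs(2)] xs(3) by simp
    then show ?thesis using r'(3) by simp
  qed
  show "inj_on (\<lambda>(x, s). {x, root_of s}) (set (child_edges t))"
  proof (rule inj_onI, clarsimp simp: doubleton_eq_iff)
    fix x s y r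
    assume *: "(x, s) \<in> set (child_edges t)" "(y, r) \<in> set (child_edges t)"
    assume "x = y \<and> root_of s = root_of r \<or> x = root_of r \<and> root_of s = y"
    then show "x = y \<and> s = r"
      using u[OF *] lt[OF *] lt[OF *(2,1)] by (metis order.asym prod.inject)
  qed
qed

primrec branch_orders :: "'a rtree \<Rightarrow> nat list" where
  "branch_orders (Node x ts) = concat (map (\<lambda>t. nverts t # branch_orders t) ts)"

lemma branch_orders_conv: "branch_orders t = map (\<lambda>(x, s). nverts s) (child_edges t)"
  by (induction t) (auto simp: map_concat o_def intro!: arg_cong[where f = concat])

lemma edges_tree_graph:
  "edges (tree_graph t) = (\<lambda>(x, s). {x, root_of s}) ` set (child_edges t)"
  by (fastforce simp: edges_def tree_arcs_def insert_commute)

text \<open>The set holds the values for both orientations, so the result depends on the graph and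
  the edge only and survives rerooting.\<close>

definition small_side :: "'a pair_pre_digraph \<Rightarrow> 'a set \<Rightarrow> nat" where
  "small_side G e = Min {n_closer G u v |u v. e = {u, v}}"

lemma n_closer_child_edge:
  assumes "distinct (labels t)" "(x, s) \<in> set (child_edges t)"
  shows "n_closer (tree_graph t) (root_of s) x = nverts s"
    and "n_closer (tree_graph t) x (root_of s) = nverts t - nverts s"
    and "nverts s \<le> nverts t"
proof -
  obtain w where w: "root_of w = x" "attach s w \<approx> t" using child_edge_rerooting[OF assms(2)] .
  have d: "distinct (labels (attach s w))" using w(2) assms(1) rerooting_distinct by blast
  have "nverts t = nverts s + nverts w"
    using rerooting_nverts[OF w(2)] by (cases w) (simp add: attach_def)
  then show "n_closer (tree_graph t) (root_of s) x = nverts s"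
    "n_closer (tree_graph t) x (root_of s) = nverts t - nverts s" "nverts s \<le> nverts t"
    using n_closer_attach[OF d] rerooting_graph[OF w(2)] w(1) by auto
qed

lemma small_side_child_edge:
  assumes "distinct (labels t)" "(x, s) \<in> set (child_edges t)"
  shows "small_side (tree_graph t) {x, root_of s} = min (nverts s) (nverts t - nverts s)"
proof -
  have "{n_closer (tree_graph t) u v |u v. {x, root_of s} = {u, v}} =
    {n_closer (tree_graph t) (root_of s) x, n_closer (tree_graph t) x (root_of s)}"
    by (auto simp: doubleton_eq_iff)
  then show ?thesis by (simp add: small_side_def n_closer_child_edge[OF assms])
qed

text \<open>Arbitrary \<open>h\<close> serves the Mostar index, the side sum and the counting of
  layers alike.\<close>

lemma sum_edges_tree_graph:
  assumes "distinct (labels t)"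
  shows "(\<Sum>e\<in>edges (tree_graph t). h (small_side (tree_graph t) e)) =
    (\<Sum>k\<leftarrow>branch_orders t. h (min k (nverts t - k)))"
proof -
  have "(\<Sum>e\<in>edges (tree_graph t). h (small_side (tree_graph t) e)) =
    (\<Sum>(x, s)\<in>set (child_edges t). h (min (nverts s) (nverts t - nverts s)))"
    unfolding edges_tree_graph
    using inj_on_child_edges[OF assms] small_side_child_edge[OF assms]
    by (subst sum.reindex) (auto intro!: sum.cong)
  then show ?thesis
    using inj_on_child_edges(2)[OF assms]
    by (simp add: branch_orders_conv sum_list_distinct_conv_sum_set o_def case_prod_unfold)
qed

definition side_sum :: "'a rtree \<Rightarrow> nat" where
  "side_sum t = (\<Sum>k\<leftarrow>branch_orders t. min k (nverts t - k))"

lemma mostar_tree_graph: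
  assumes "distinct (labels t)"
  shows "mostar (tree_graph t) = int (nverts t) * (int (nverts t) - 1) - 2 * int (side_sum t)"
proof -
  let ?G = "tree_graph t" and ?n = "nverts t"
  have "(THE d. \<exists>u v. e = {u, v} \<and> d = \<bar>int (n_closer ?G u v) - int (n_closer ?G v u)\<bar>) =
      int ?n - 2 * int (small_side ?G e)" if e: "e \<in> edges ?G" for e
  proof -
    obtain x s where xs: "(x, s) \<in> set (child_edges t)" "e = {x, root_of s}"
      using e by (auto simp: edges_tree_graph)
    note n = n_closer_child_edge[OF assms xs(1)]
    have *: "\<bar>int (nverts s) - int (?n - nverts s)\<bar>
      = int ?n - 2 * int (min (nverts s) (?n - nverts s))"
      "\<bar>int (?n - nverts s) - int (nverts s)\<bar> = int ?n - 2 * int (min (nverts s) (?n - nverts s))"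
      using n(3) by auto
    show ?thesis
      unfolding xs(2) small_side_child_edge[OF assms xs(1)]
    \<comment> \<open>The description is well defined because both orientations of the edge give the
      same value.\<close>
    proof (rule the_equality)
      show "\<exists>u v. {x, root_of s} = {u, v} \<and> int ?n - 2 * int (min (nverts s) (?n - nverts s)) =
          \<bar>int (n_closer ?G u v) - int (n_closer ?G v u)\<bar>"
        by (intro exI[of _ x] exI[of _ "root_of s"]) (simp only: n * simp_thms)
    next
      fix d
      assume "\<exists>u v. {x, root_of s} = {u, v} \<and> d = \<bar>int (n_closer ?G u v) - int (n_closer ?G v u)\<bar>"
      then have "d = \<bar>int (n_closer ?G x (root_of s)) - int (n_closer ?G (root_of s) x)\<bar> \<or>
          d = \<bar>int (n_closer ?G (root_of s) x) - int (n_closer ?G x (root_of s))\<bar>"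
        by (auto simp: doubleton_eq_iff)
      then show "d = int ?n - 2 * int (min (nverts s) (?n - nverts s))"
        by (simp only: n * simp_thms)
    qed
  qed
  then have "mostar ?G = (\<Sum>e\<in>edges ?G. int ?n - 2 * int (small_side ?G e))"
    unfolding mostar_def by (rule sum.cong[OF refl])
  also have "\<dots> = (\<Sum>k\<leftarrow>branch_orders t. int ?n - 2 * int (min k (?n - k)))"
    by (rule sum_edges_tree_graph[OF assms])
  also have "\<dots> = int (length (branch_orders t)) * int ?n - 2 * int (\<Sum>k\<leftarrow>branch_orders t. min k (?n
    - k))"
  proof -
    have "(\<Sum>k\<leftarrow>ks. int n - 2 * int (f k)) = int (length ks) * int n - 2 * int (\<Sum>k\<leftarrow>ks. f k)"
      for f n and ks :: "nat list"
      by (induction ks) (auto simp: algebra_simps)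
    then show ?thesis .
  qed
  also have "int (length (branch_orders t)) = int ?n - 1"
    using nverts_pos[of t] by (simp add: branch_orders_conv length_child_edges)
  finally show ?thesis by (simp add: side_sum_def algebra_simps)
qed

section \<open>Odd vertices and smaller sides\<close>

text \<open>The degree in the whole tree when \<open>t\<close> is one side of a split edge: the root
  gains the edge to the other side.\<close>

definition up_degree :: "'a rtree \<Rightarrow> 'a \<Rightarrow> nat" where
  "up_degree t v = card {y. (v, y) \<in> parcs (tree_graph t)} + (if v = root_of t then 1 else 0)"

lemma out_degree_with_proj: "out_degree (with_proj G) v = card {y. (v, y) \<in> parcs G}"
proof -
  have "out_arcs (with_proj G) v = Pair v ` {y. (v, y) \<in> parcs G}"
    by (auto simp: out_arcs_def)
  then show ?thesis by (simp add: out_degree_def card_image inj_on_def)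
qed

lemma out_degree_attach:
  assumes "distinct (labels (attach u w))" "v \<in> set (labels u)"
  shows "out_degree (with_proj (tree_graph (attach u w))) v = up_degree u v"
proof -
  let ?N = "{y. (v, y) \<in> parcs (tree_graph u)}"
  have w: "root_of w \<notin> ?N" "v \<noteq> root_of w"
    using assms root_in_labels[of w] tree_arcs_labels[of v "root_of w" u] tree_arcs_labels[of
      "root_of w" v u]
    by (auto simp: distinct_labels_attach)
  have "{y. (v, y) \<in> parcs (tree_graph (attach u w))} = ?N \<union> (if v
    = root_of u then {root_of w} else {})"
    using assms w(2) tree_arcs_labels[of v _ w] tree_arcs_labels[of _ v w]
    by (auto simp: tree_arcs_attach distinct_labels_attach)
  moreover have "finite ?N"
    using finite_subset[of ?N
      "set (labels u)"] tree_arcs_labels[of v _ u] tree_arcs_labels[of _ v u]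
    by auto
  ultimately show ?thesis
    using w(1) by (cases "v
      = root_of u") (simp_all add: out_degree_with_proj up_degree_def del: tree_graph_simps)
qed

lemma up_degree_Node:
  assumes "distinct (labels (Node x ts))"
  shows "up_degree (Node x ts) x = Suc (length ts)"
    and "t \<in> set ts \<Longrightarrow> v \<in> set (labels t) \<Longrightarrow> up_degree (Node x ts) v = up_degree t v"
proof -
  have "{y. (x, y) \<in> parcs (tree_graph (Node x ts))} = root_of ` set ts"
    using assms tree_arcs_labels[of x] tree_arcs_labels[of _ x] by (fastforce simp: tree_arcs_Node)
  moreover have "distinct (map root_of ts)"
    using assms
  proof (induction ts)
    case (Cons t ts)
    have "root_of t \<noteq> root_of u" if "u \<in> set ts" for u
    proof -
      have "set (labels t) \<inter> set (labels u) = {}" using Cons.prems that by auto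
      then show ?thesis by (metis disjoint_iff root_in_labels)
    qed
    then show ?case using Cons by auto
  qed simp
  ultimately show "up_degree (Node x ts) x = Suc (length ts)"
    using distinct_card[of "map root_of ts"] by (simp add: up_degree_def)
next
  assume t: "t \<in> set ts" and v: "v \<in> set (labels t)"
  let ?w = "Node x (remove1 t ts)"
  have a: "attach t ?w \<approx> Node x ts"
    unfolding attach_def using t by (auto intro!: rerooting_mset)
  have d: "distinct (labels (attach t ?w))" using a assms rerooting_distinct by blast
  have "v \<noteq> x" using t v assms by auto
  then show "up_degree (Node x ts) v = up_degree t v"
    using out_degree_attach[OF d v] rerooting_graph[OF a]
    by (simp add: up_degree_def out_degree_with_proj)
qed

text \<open>With \<open>l\<close> children, the subtrees contribute \<open>l\<close> plus an even
  number, and the root is odd iff \<open>l\<close> is even. Either way \<open>l\<close> is completed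
  to \<open>2 * (l div 2) + 1\<close>.\<close>

lemma odd_up_degree_count:
  "distinct (labels t) \<Longrightarrow> length (filter (\<lambda>v. odd (up_degree t v)) (labels t)) = 2 * half_odd t + 1"
proof (induction t)
  case (Node x ts)
  note d = Node.prems
  have *: "length (filter (\<lambda>v. odd (up_degree (Node x ts) v)) (labels t)) = 2 * half_odd t + 1"
    if "t \<in> set ts" for t
  proof -
    have "distinct (labels t)" using d that by (auto simp: distinct_concat_iff)
    moreover have "filter (\<lambda>v. odd (up_degree (Node x ts) v)) (labels t)
      = filter (\<lambda>v. odd (up_degree t v)) (labels t)"
      using up_degree_Node(2)[OF d that] by (intro filter_cong) auto
    ultimately show ?thesis using Node.IH[OF that] by simp
  qed
  have "length (filter P (concat (map labels us))) = 2 * sum_list (map half_odd us) + length us"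
    if "\<forall>t\<in>set us. length (filter P (labels t)) = 2 * half_odd t + 1"
      for us :: "'a rtree list" and P
    using that by (induction us) auto
  then have "length (filter (\<lambda>v. odd (up_degree (Node x ts) v)) (concat (map labels ts))) =
      2 * sum_list (map half_odd ts) + length ts"
    using * by blast
  then show ?case using up_degree_Node(1)[OF d] by simp
qed

lemma card_odd_vertices_attach:
  assumes "distinct (labels (attach u w))"
  shows "card (odd_vertices (tree_graph (attach u w))) = 2 * (half_odd u + half_odd w + 1)"
proof -
  let ?G = "tree_graph (attach u w)"
  have d: "distinct (labels (attach w u))" "distinct (labels u)" "distinct (labels w)"
    using assms attach_commute rerooting_distinct distinct_labels_attach by blast+
  have g: "tree_graph (attach w u) = ?G"
    using attach_commute rerooting_graph by blast
  have c: "card {v \<in> set (labels t). odd (up_degree t v)} = 2 * half_odd t + 1"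
    if "distinct (labels t)" for t :: "'a rtree"
    using odd_up_degree_count[OF that] that distinct_card[of
      "filter (\<lambda>v. odd (up_degree t v)) (labels t)"]
    by simp
  have "odd_vertices ?G = {v \<in> set (labels u). odd (up_degree u v)}
    \<union> {v \<in> set (labels w). odd (up_degree w v)}"
    using out_degree_attach[OF assms] out_degree_attach[OF d(1)]
    by (auto simp: odd_vertices_def set_labels_attach g)
  also have "card \<dots> = 2 * half_odd u + 1 + (2 * half_odd w + 1)"
    using assms by (subst card_Un_disjoint) (auto simp: c d(2,3) distinct_labels_attach)
  finally show ?thesis by simp
qed

section \<open>Branch orders and layers of edges\<close>

lemma branch_orders_attach:
  "sum_list (map h (branch_orders (attach u w))) =
    h (nverts u) + sum_list (map h (branch_orders u)) + (sum_list (map h (branch_orders w)) :: 'b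
      :: comm_monoid_add)"
  by (cases w) (simp add: attach_def ac_simps)

lemma nverts_attach: "nverts (attach u w) = nverts u + nverts w"
  by (cases w) (simp add: attach_def)

lemma sum_branch_orders: "sum_list (branch_orders t) + nverts t = sum_nverts t"
proof (induction t)
  case (Node x ts)
  then have "sum_list (branch_orders (Node x ts)) = sum_list (map sum_nverts ts)"
    by (induction ts) (auto simp: ac_simps)
  then show ?case by simp
qed

lemma n_large_conv:
  "n_large m t = (if m \<le> nverts t then 1 else 0) + length (filter (\<lambda>k. m \<le> k) (branch_orders t))"
proof (induction t)
  case (Node x ts)
  then have "sum_list (map (n_large m) ts) = length (filter (\<lambda>k. m
    \<le> k) (branch_orders (Node x ts)))"
    by (induction ts) (auto)
  then show ?case by simp
qed

lemma branch_orders_less: "k \<in> set (branch_orders t) \<Longrightarrow> k < nverts t"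
proof (induction t)
  case (Node x ts)
  then obtain t where "t \<in> set ts" "k \<le> nverts t" by fastforce
  then show ?case using member_le_sum_list[of "nverts t" "map nverts ts"] by auto
qed

text \<open>The complement of a branch of one part contains the other part, of order at least
  \<open>m\<close>, so only the branch order matters. The joining edge is counted at both roots,
  whence \<open>+ 1\<close>.\<close>

lemma edges_with_large_side:
  assumes "distinct (labels (attach u w))" "1 \<le> m" "m \<le> nverts u" "m \<le> nverts w"
  shows "card {e \<in> edges (tree_graph (attach u w)). m
    \<le> small_side (tree_graph (attach u w)) e} + 1 =
    n_large m u + n_large m w"
proof -
  let ?G = "tree_graph (attach u w)" and ?n = "nverts u + nverts w"
  have fin: "finite (edges ?G)" by (simp add: edges_tree_graph)
  let ?h = "\<lambda>k. if m \<le> k then 1 else (0::nat)"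
  have count: "(\<Sum>k\<leftarrow>branch_orders t. ?h (min k (?n - k))) = length (filter (\<lambda>k. m
    \<le> k) (branch_orders t))"
    if "nverts t + m \<le> ?n" for t :: "'a rtree"
  proof -
    have "(\<Sum>k\<leftarrow>ks. ?h (min k (?n - k))) = length (filter (\<lambda>k. m \<le> k) ks)"
      if "\<forall>k\<in>set ks. k + m \<le> ?n" for ks
      using that by (induction ks) auto
    then show ?thesis using branch_orders_less[of _ t] that by fastforce
  qed
  have "card {e \<in> edges ?G. m \<le> small_side ?G e} = (\<Sum>e\<in>edges ?G. ?h (small_side ?G e))"
    using fin by (simp add: sum.If_cases Int_def)
  also have "\<dots> = (\<Sum>k\<leftarrow>branch_orders (attach u w). ?h (min k (?n - k)))"
    using sum_edges_tree_graph[OF assms(1), of ?h] by (simp add: nverts_attach)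
  also have "\<dots> = 1 + length (filter (\<lambda>k. m \<le> k) (branch_orders u)) + length (filter (\<lambda>k. m
    \<le> k) (branch_orders w))"
    unfolding branch_orders_attach using assms count[of u] count[of w] by simp
  finally show ?thesis using assms(3,4) by (simp add: n_large_conv)
qed

text \<open>Double counting: an edge is counted once for every \<open>m\<close> up to its smaller
  side.\<close>

lemma sum_small_side:
  assumes "distinct (labels t)"
  shows "(\<Sum>e\<in>edges (tree_graph t). small_side (tree_graph t) e) = 
    (\<Sum>m=1..nverts t div 2. card {e \<in> edges (tree_graph t). m \<le> small_side (tree_graph t) e})"
proof -
  let ?G = "tree_graph t"
  have fin: "finite (edges ?G)" by (simp add: edges_tree_graph)
  have le: "small_side ?G e \<le> nverts t div 2" if "e \<in> edges ?G" for e
    using that small_side_child_edge[OF assms] by (auto simp: edges_tree_graph)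
  have "small_side ?G e = (\<Sum>m=1..nverts t div 2. if m \<le> small_side ?G e then 1 else 0)"
    if "e \<in> edges ?G" for e
  proof -
    have "{1..nverts t div 2} \<inter> {m. m \<le> small_side ?G e} = {1..small_side ?G e}" using le[OF that]
      by auto
    then show ?thesis by (simp add: sum.If_cases)
  qed
  then have "(\<Sum>e\<in>edges ?G. small_side ?G e) =
      (\<Sum>e\<in>edges ?G. \<Sum>m=1..nverts t div 2. if m \<le> small_side ?G e then 1 else 0)"
    by (rule sum.cong[OF refl])
  also have "\<dots> = (\<Sum>m=1..nverts t div 2. \<Sum>e\<in>edges ?G. if m \<le> small_side ?G e then 1 else 0)"
    by (rule sum.swap)
  also have "\<dots> = (\<Sum>m=1..nverts t div 2. card {e \<in> edges ?G. m \<le> small_side ?G e})"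
    using fin by (intro sum.cong) (simp_all add: sum.If_cases Int_def)
  finally show ?thesis .
qed

lemma edge_attach:
  assumes "distinct (labels t)" "e \<in> edges (tree_graph t)"
  obtains u w where "attach u w \<approx> t" "nverts u \<le> nverts w" "nverts u = small_side (tree_graph t) e"
proof -
  obtain x s where xs: "(x, s) \<in> set (child_edges t)" "e = {x, root_of s}"
    using assms(2) by (auto simp: edges_tree_graph)
  obtain w where w: "root_of w = x" "attach s w \<approx> t" using child_edge_rerooting[OF xs(1)] .
  have n: "nverts t = nverts s + nverts w" using rerooting_nverts[OF w(2)]
    by (simp add: nverts_attach)
  have e: "small_side (tree_graph t) e = min (nverts s) (nverts w)"
    using small_side_child_edge[OF assms(1) xs(1)] xs(2) n by simp
  show ?thesis
  proof (cases "nverts s \<le> nverts w")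
    case True
    then show ?thesis by (intro that[OF w(2)]) (use e in auto)
  next
    case False
    have "attach w s \<approx> t" using w(2) attach_commute rerooting_trans by blast
    then show ?thesis by (rule that[of w s]) (use e False in auto)
  qed
qed

section \<open>The extremal bound\<close>

text \<open>The terms \<open>4 * ((i + 1) div 2)\<close> sum to
  \<open>l^2 + 2 * l + l mod 2\<close>; doubling avoids fractions.\<close>

lemma layer_sum_le:
  fixes N :: "nat \<Rightarrow> int" and n \<kappa> :: int
  assumes "\<And>i. 1 \<le> i \<Longrightarrow> i \<le> l \<Longrightarrow> N (i + 1) + 1 + \<kappa> + 2 * int ((i + 1) div 2) \<le> n"
  shows "2 * (\<Sum>i=1..l. N (i + 1)) \<le>
    2 * int l * (n - 1) - 2 * int l * \<kappa> - int l ^ 2 - 2 * int l - int (l mod 2)"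
  using assms
proof (induction l)
  case (Suc l)
  have "4 * int ((Suc l + 1) div 2) = 2 * int l + 3 + int (Suc l mod 2) - int (l mod 2)"
    by (cases "even l") (auto elim!: evenE oddE)
  then have "2 * N (Suc l + 1)
    \<le> 2 * (n - 1) - 2 * \<kappa> - (2 * int l + 3 + int (Suc l mod 2) - int (l mod 2))"
    using Suc.prems[of "Suc l"] by simp
  moreover have "2 * (\<Sum>i=1..l. N (i + 1)) \<le>
    2 * int l * (n - 1) - 2 * int l * \<kappa> - int l ^ 2 - 2 * int l - int (l mod 2)"
    using Suc by simp
  moreover have "2 * int (Suc l) * (n - 1) - 2 * int (Suc l) * \<kappa> - int (Suc l) ^ 2 - 2 * int (Suc
    l) =
    2 * int l * (n - 1) - 2 * int l * \<kappa> - int l ^ 2 - 2 * int l + (2 * (n - 1) - 2 * \<kappa> - (2 * int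
      l + 3))"
    by (simp add: power2_eq_square algebra_simps)
  ultimately show ?case by simp
qed simp

text \<open>The first bound is at least as strong as the second for \<open>i <= \<kappa>\<close>,
  and the second at least as strong beyond, so the sum switches at \<open>\<kappa>\<close>.\<close>

lemma layer_sum_le':
  fixes N :: "nat \<Rightarrow> int" and n :: int and \<kappa> :: nat
  assumes "\<And>i. 1 \<le> i \<Longrightarrow> i \<le> \<kappa> \<Longrightarrow> N (i + 1) + 1 + int \<kappa> + 2 * int ((i + 1) div 2) \<le> n"
    and "\<And>i. 1 \<le> i \<Longrightarrow> i \<le> l \<Longrightarrow> N (i + 1) + 1 + 2 * int i \<le> n" and "\<kappa> \<le> l"
  shows "2 * (\<Sum>i=1..l. N (i + 1)) \<le>
    2 * int l * (n - 1) - 2 * int l * (int l + 1) - int \<kappa> ^ 2 - int (\<kappa> mod 2)"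
  using assms(3,2)
proof (induction l rule: dec_induct)
  case base
  then show ?case
    using layer_sum_le[of \<kappa> N "int \<kappa>" n] assms(1) by (simp add: power2_eq_square algebra_simps)
next
  case (step l)
  have "2 * N (Suc l + 1) \<le> 2 * (n - 1) - 4 * (int l + 1)"
    using step.prems[of "Suc l"] by simp
  moreover have "2 * (\<Sum>i=1..l. N (i + 1)) \<le>
    2 * int l * (n - 1) - 2 * int l * (int l + 1) - int \<kappa> ^ 2 - int (\<kappa> mod 2)"
    using step by simp
  moreover have "2 * int (Suc l) * (n - 1) - 2 * int (Suc l) * (int (Suc l) + 1) =
    2 * int l * (n - 1) - 2 * int l * (int l + 1) + (2 * (n - 1) - 4 * (int l + 1))"
    by (simp add: algebra_simps)
  ultimately show ?case by simp
qed

text \<open>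
  \<open>N m\<close> stands for the number of edges whose smaller side is at least \<open>m\<close>.
\<close>

lemma top_layer_nonempty:
  fixes N :: "nat \<Rightarrow> nat" and n k :: nat
  defines "M \<equiv> n div 2"
  assumes "1 \<le> k" "k \<le> M" "N 1 + 1 \<le> n"
    and bound1: "\<And>i. 1 \<le> i \<Longrightarrow> N (i + 1) \<noteq> 0 \<Longrightarrow> N (i + 1) + k + 2 * ((i + 1) div 2) \<le> n"
    and bound2: "\<And>i. 1 \<le> i \<Longrightarrow> N (i + 1) \<noteq> 0 \<Longrightarrow> N (i + 1) + 1 + 2 * i \<le> n"
    and large: "2 * int M * (int n - int M)
      \<le> 2 * int (\<Sum>m=1..M. N m) + (int k - 1)\<^sup>2 + int ((k - 1) mod 2)"
  shows "N M \<noteq> 0 \<or> n = 2 * k \<and> even k \<and> N (k - 1) \<noteq> 0"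
proof (rule ccontr)
  assume neg: "\<not> ?thesis"
  define \<kappa> where "\<kappa> = k - 1"
  have k: "k = \<kappa> + 1" "int k - 1 = int \<kappa>" using assms(2) by (auto simp: \<kappa>_def)
  have n: "2 * M \<le> n" "n \<le> 2 * M + 1" by (auto simp: M_def)
  \<comment> \<open>\<open>bound1\<close> does not cover empty layers; for these the estimate
    follows from \<open>i + 1 <= M - 1\<close> and \<open>k <= M\<close>.\<close>
  have b1: "int (N (i + 1)) + 1 + int \<kappa> + 2 * int ((i + 1) div 2) \<le> int n" if "1 \<le> i" "i \<le> M - 2"
    for i
  proof (cases "N (i + 1) = 0")
    case True
    have "2 * ((i + 1) div 2) \<le> i + 1" by simp
    then have "1 + \<kappa> + 2 * ((i + 1) div 2) \<le> n" using that assms(3) k(1) n(1) by linarith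
    then show ?thesis using True by linarith
  next
    case False
    then have "N (i + 1) + k + 2 * ((i + 1) div 2) \<le> n" using bound1 that by blast
    then show ?thesis using k by linarith
  qed
  have b2: "int (N (i + 1)) + 1 + 2 * int i \<le> int n" if "1 \<le> i" "i \<le> M - 2" for i
  proof (cases "N (i + 1) = 0")
    case False
    then have "N (i + 1) + 1 + 2 * i \<le> n" using bound2 that by blast
    then show ?thesis by linarith
  qed (use that n(1) in linarith)
  have sum: "(\<Sum>m=1..l + 1. int (N m)) = int (N 1) + (\<Sum>i=1..l. int (N (i + 1)))" for l
    by (induction l) auto
  have M: "2 \<le> M"
  proof (rule ccontr)
    assume "\<not> 2 \<le> M"
    then have "M = 1" "k = 1" using assms(2,3) by auto
    then show False using large neg n by simp
  qed
  \<comment> \<open>The number of layers from 2 to \<open>M - 1\<close>. Layer \<open>M\<close> is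
    empty by assumption, and layer 1 has at most \<open>n - 1\<close> edges.\<close>
  define l where "l = M - 2"
  have Ms: "M = Suc (l + 1)" using M by (simp add: l_def)
  then have "N (Suc (l + 1)) = 0" using neg by simp
  then have "int (\<Sum>m=1..M. N m) = (\<Sum>m=1..l + 1. int (N m))" unfolding Ms by simp
  then have W: "int (\<Sum>m=1..M. N m) = int (N 1) + (\<Sum>i=1..l. int (N (i + 1)))"
    using sum by simp
  have Ml: "int M = int l + 2" using M by (simp add: l_def)
  have N1: "int (N 1) \<le> int n - 1" using assms(4) by linarith
  note big = large[unfolded W k(2), folded \<kappa>_def]
  show False
  proof (cases "\<kappa> \<le> l")
    case True
    have 1: "2 * (\<Sum>i=1..l. int (N (i + 1))) \<le>
      2 * int l * (int n - 1) - 2 * int l * (int l + 1) - int \<kappa> ^ 2 - int (\<kappa> mod 2)"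
      by (rule layer_sum_le') (use True b1 b2 in \<open>auto simp: l_def\<close>)
    have 2: "2 * int M * (int n - int M)
      = 2 * int l * (int n - 1) - 2 * int l * (int l + 1) + 4 * int n - 4 * int l - 8"
      by (simp add: Ml algebra_simps)
    have 3: "2 * int l + 4 \<le> int n" using n(1) Ml by linarith
    have False if "2 * S \<le> A - B - c - p" "T = A - B + 4 * n - 4 * l - 8" "2 * l + 4 \<le> n"
      "T \<le> 2 * (x + S) + c + p" "x \<le> n - 1" for A B S T c p n l x :: int
      using that by (smt (verit))
    from this[OF 1 2 3 big N1] show False .
  next
    case False
    \<comment> \<open>Here \<open>k = M\<close>, and the estimate is so tight that parities decide:
      only \<open>l\<close> even with \<open>n = 2 * l + 4\<close> is left, which is the exceptional
      case.\<close>
    then have \<kappa>: "\<kappa> = l + 1" using assms(3) k M by (auto simp: l_def)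
    have 1: "2 * (\<Sum>i=1..l. int (N (i + 1))) \<le>
      2 * int l * (int n - 1) - 2 * int l * int \<kappa> - int l ^ 2 - 2 * int l - int (l mod 2)"
      by (rule layer_sum_le) (use b1 in \<open>auto simp: l_def\<close>)
    have 2: "2 * int M * (int n - int M) - int \<kappa> ^ 2 =
      2 * int l * (int n - 1) - 2 * int l * int \<kappa> - int l ^ 2 - 2 * int l + (4 * int n - 4 * int l
        - 9)"
      by (simp add: Ml \<kappa> power2_eq_square algebra_simps)
    have "2 * n \<le> 4 * l + 7 + p - q" if "2 * S \<le> A - q" "T - c = A + (4 * n - 4 * l - 9)"
      "T \<le> 2 * (x + S) + c + p" "x \<le> n - 1" for A S T c p q n l x :: int
      using that by (smt (verit))
    from this[OF 1 2 big N1] have 3: "2 * int n \<le> 4 * int l + 7 + int (\<kappa> mod 2) - int (l mod 2)" .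
    have 4: "2 * l + 4 \<le> n" using n(1) Ms by linarith
    have l: "even l"
    proof (rule ccontr)
      assume "odd l"
      then have "l mod 2 = 1" "\<kappa> mod 2 = 0" unfolding \<kappa> by (simp_all add: odd_iff_mod_2_eq_one)
      with 3 have "2 * int n \<le> 4 * int l + 6" by simp
      then show False using 4 by linarith
    qed
    then have "l mod 2 = 0" "\<kappa> mod 2 = 1" unfolding \<kappa>
      by (simp_all add: even_iff_mod_2_eq_zero mod_Suc)
    with 3 have "2 * int n \<le> 4 * int l + 8" by simp
    then have n2: "n = 2 * l + 4" using 4 by linarith
    have kl: "k = l + 2" using k(1) \<kappa> by linarith
    have ex: "n = 2 * k" "even k" unfolding kl n2 using l by simp_all
    have "k - 1 = l + 1" using kl by simp
    then have N0: "N (l + 1) = 0" using neg ex by metis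
    show False
    proof (cases "l = 0")
      case True
      then show False using big N0 n2 Ml Ms \<kappa> by simp
    next
      case False
      \<comment> \<open>Now layer \<open>l + 1 = k - 1\<close> is empty too, so the sum already
        stops at \<open>j\<close>, which gives the contradiction.\<close>
      define j where "j = l - 1"
      have j: "l = j + 1" using False by (simp add: j_def)
      have 1: "2 * (\<Sum>i=1..j. int (N (i + 1))) \<le>
        2 * int j * (int n - 1) - 2 * int j * int \<kappa> - int j ^ 2 - 2 * int j - int (j mod 2)"
        by (rule layer_sum_le) (use b1 in \<open>auto simp: l_def j_def\<close>)
      have 2: "(\<Sum>i=1..l. int (N (i + 1))) = (\<Sum>i=1..j. int (N (i + 1)))"
        using N0 by (simp add: j)
      have 3: "2 * int M * (int n - int M) - int \<kappa> ^ 2 =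
        2 * int j * (int n - 1) - 2 * int j * int \<kappa> - int j ^ 2 - 2 * int j + (4 * int j + 14)"
        by (simp add: Ml \<kappa> j n2 power2_eq_square algebra_simps)
      have 4: "int n = 2 * int j + 6" using n2 j by simp
      have 5: "int (\<kappa> mod 2) \<le> 1" by presburger
      have False if "2 * S \<le> A - q" "S' = S" "T - c = A + (4 * j + 14)" "n = 2 * j + 6"
        "p \<le> 1" "0 \<le> q" "T \<le> 2 * (x + S') + c + p" "x \<le> n - 1" for A S S' T c p q n j x :: int
        using that by (smt (verit))
      from this[OF 1 2 3 4 5 _ big N1] show False by simp
    qed
  qed
qed

text \<open>\<open>2 * a^2 + 2 * b^2 = (a + b)^2 + (a - b)^2\<close>, and the last square is at
  least the parity of \<open>a + b\<close>.\<close>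

lemma sum_squares_balanced:
  fixes a b :: nat
  shows "int ((a + b) mod 2) + (int (a + b))\<^sup>2 \<le> 2 * (int a)\<^sup>2 + 2 * (int b)\<^sup>2"
    and "2 * (int a)\<^sup>2 + 2 * (int b)\<^sup>2 = int ((a + b) mod 2) + (int (a + b))\<^sup>2 \<Longrightarrow>
      a = (a + b) div 2 \<or> b = (a + b) div 2"
proof -
  have e: "2 * (int a)\<^sup>2 + 2 * (int b)\<^sup>2 = (int (a + b))\<^sup>2 + (int a - int b)\<^sup>2"
    by (simp add: power2_eq_square algebra_simps)
  have "int ((a + b) mod 2) \<le> (int a - int b)\<^sup>2"
  proof (cases "a = b")
    case False
    then have "0 < (int a - int b)\<^sup>2" by simp
    moreover have "int ((a + b) mod 2) \<le> 1" by presburger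
    ultimately show ?thesis by linarith
  qed simp
  then show "int ((a + b) mod 2) + (int (a + b))\<^sup>2 \<le> 2 * (int a)\<^sup>2 + 2 * (int b)\<^sup>2"
    using e by linarith
  assume "2 * (int a)\<^sup>2 + 2 * (int b)\<^sup>2 = int ((a + b) mod 2) + (int (a + b))\<^sup>2"
  then have "(int a - int b)\<^sup>2 \<le> 1" using e by (smt (verit) mod_2_le_1 of_nat_1 of_nat_le_iff)
  then have "\<bar>int a - int b\<bar> \<le> 1" by (simp add: abs_square_le_1)
  then show "a = (a + b) div 2 \<or> b = (a + b) div 2" by linarith
qed

text \<open>Each minimum is at most the branch order. The sums on the right contain the orders of
  both parts, while the joining edge contributes only the smaller one.\<close>

lemma side_sum_attach_le:
  assumes "nverts u \<le> nverts w"
  shows "side_sum (attach u w) + nverts w \<le> sum_nverts u + sum_nverts w"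
proof -
  have "(\<Sum>k\<leftarrow>ks. min k (n - k)) \<le> sum_list ks" for ks :: "nat list" and n
    by (induction ks) auto
  then have "side_sum (attach u w)
    \<le> nverts u + sum_list (branch_orders u) + sum_list (branch_orders w)"
    unfolding side_sum_def branch_orders_attach by (intro add_mono) auto
  then show ?thesis using sum_branch_orders[of u] sum_branch_orders[of w] by linarith
qed

text \<open>Branches are strictly smaller than their part, hence at most half of the total order,
  where the minimum is the branch order itself.\<close>

lemma side_sum_attach_eq:
  assumes "nverts u \<le> (nverts u + nverts w) div 2 + 1" "nverts w \<le> (nverts u + nverts w) div 2 + 1"
  shows "side_sum (attach u w) + max (nverts u) (nverts w) = sum_nverts u + sum_nverts w"
proof -
  let ?n = "nverts u + nverts w"
  have "(\<Sum>k\<leftarrow>ks. min k (n - k)) = sum_list ks" if "\<forall>k\<in>set ks. k \<le> n div 2" for ks :: "nat list" and n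
    using that by (induction ks) auto
  moreover have "\<forall>k\<in>set (branch_orders u). k \<le> ?n div 2" "\<forall>k\<in>set (branch_orders w). k \<le> ?n div 2"
    using branch_orders_less[of _ u] branch_orders_less[of _ w] assms by fastforce+
  ultimately have "side_sum (attach u w)
    = min (nverts u) (nverts w) + sum_list (branch_orders u) + sum_list (branch_orders w)"
    unfolding side_sum_def branch_orders_attach nverts_attach by simp
  then show ?thesis using sum_branch_orders[of u] sum_branch_orders[of w] by linarith
qed

text \<open>\<open>large\<close> says that the side sum reaches the bound: its last two summands are
  \<open>2 * a^2 + 2 * b^2\<close> for the balanced halves \<open>a\<close>, \<open>b\<close> of
  \<open>k - 1\<close>.\<close>

lemma extremal_split:
  fixes t :: "'a rtree"
  defines "n \<equiv> nverts t" and "M \<equiv> nverts t div 2"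
  assumes d: "distinct (labels t)" and odd: "card (odd_vertices (tree_graph t)) = 2 * k"
    and k: "1 \<le> k" "k \<le> M"
    and large: "2 * int M * (int n - int M)
      \<le> 2 * int (side_sum t) + (int k - 1)\<^sup>2 + int ((k - 1) mod 2)"
  obtains u w where "attach u w \<approx> t" "caterpillar u" "caterpillar w"
    "half_odd u = k - 1 - (k - 1) div 2" "half_odd w = (k - 1) div 2"
proof -
  let ?G = "tree_graph t"
  define N where "N m = card {e \<in> edges ?G. m \<le> small_side ?G e}" for m
  have fin: "finite (edges ?G)" by (simp add: edges_tree_graph)
  have half: "half_odd u + half_odd w + 1 = k" "nverts u + nverts w = n"
    "distinct (labels (attach u w))"
    "side_sum (attach u w) = side_sum t" if "attach u w \<approx> t" for u w
  proof -
    show d': "distinct (labels (attach u w))" using that d rerooting_distinct by blast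
    show n': "nverts u + nverts w = n" using rerooting_nverts[OF that]
      by (simp add: n_def nverts_attach)
    show "half_odd u + half_odd w + 1 = k"
      using card_odd_vertices_attach[OF d'] rerooting_graph[OF that] odd by simp
    show "side_sum (attach u w) = side_sum t"
      using sum_edges_tree_graph[OF d', of id] sum_edges_tree_graph[OF d, of id]
        rerooting_graph[OF that]
      by (simp add: side_sum_def)
  qed
  have split: "\<exists>u w. attach u w \<approx> t \<and> m \<le> nverts u \<and> nverts u \<le> nverts w" if Nm: "N m \<noteq> 0" for m
  proof -
    obtain e where "e \<in> edges ?G" "m \<le> small_side ?G e"
      using Nm unfolding N_def by (metis (no_types, lifting) card.empty empty_Collect_eq)
    then show ?thesis using edge_attach[OF d] by metis
  qed
  \<comment> \<open>Add the bounds for the two parts of a split in layer \<open>m\<close>, whose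
    \<open>half_odd\<close> values sum to \<open>k - 1\<close>; the joining edge is counted
    twice.\<close>
  have bounds: "N m + k + 2 * (m div 2) \<le> n" "N m + 2 * m \<le> n + 1" if m: "2 \<le> m" "N m \<noteq> 0" for m
  proof -
    obtain u w where uw: "attach u w \<approx> t" "m \<le> nverts u" "nverts u \<le> nverts w"
      using split[OF m(2)] by blast
    have "N m + 1 = n_large m u + n_large m w"
      using edges_with_large_side[OF half(3)[OF uw(1)], of m] uw m(1)
      by (simp add: N_def rerooting_graph[OF uw(1)])
    then show "N m + k + 2 * (m div 2) \<le> n" "N m + 2 * m \<le> n + 1"
      using n_large_half_odd_le[of m u] n_large_half_odd_le[of m w] n_large_le[of m u]
        n_large_le[of m w]
        half(1,2)[OF uw(1)] uw(2,3) m(1) by linarith+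
  qed
  have "N 1 \<le> card (edges ?G)" unfolding N_def using fin by (intro card_mono) auto
  also have "\<dots> \<le> n - 1"
    unfolding edges_tree_graph n_def length_child_edges[symmetric]
    by (meson List.finite_set card_image_le card_length le_trans)
  finally have N1: "N 1 + 1 \<le> n" using nverts_pos[of t] by (simp add: n_def)
  have side: "side_sum t = (\<Sum>m=1..M. N m)"
    using sum_small_side[OF d] sum_edges_tree_graph[OF d, of id]
    by (simp add: side_sum_def M_def N_def)
  have Mn: "M = n div 2" by (simp add: M_def n_def)
  have "N M \<noteq> 0 \<or> n = 2 * k \<and> even k \<and> N (k - 1) \<noteq> 0"
    unfolding Mn
  proof (rule top_layer_nonempty)
    fix i :: nat assume i: "1 \<le> i" "N (i + 1) \<noteq> 0"
    show "N (i + 1) + k + 2 * ((i + 1) div 2) \<le> n" using bounds(1)[of "i + 1"] i by simp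
    show "N (i + 1) + 1 + 2 * i \<le> n" using bounds(2)[of "i + 1"] i by simp
  qed (use k N1 large in \<open>simp_all add: side flip: Mn\<close>)
  then obtain u w where uw: "attach u w \<approx> t" "nverts u \<le> nverts w"
    "M \<le> nverts u \<or> n = 2 * k \<and> even k \<and> k - 1 \<le> nverts u"
    using split by metis
  note h = half[OF uw(1)]
  have sq: "2 * int (side_sum t) + 2 * int (nverts w) + 2 * (int (half_odd u))\<^sup>2 + 2 * (int
    (half_odd w))\<^sup>2 \<le>
      2 * int (sum_nverts u) + 2 * (int (half_odd u))\<^sup>2 + (2 * int (sum_nverts w) + 2 * (int
        (half_odd w))\<^sup>2)"
    using side_sum_attach_le[OF uw(2)] h(4) by linarith
  have le: "2 * int (sum_nverts v) + 2 * (int (half_odd v))\<^sup>2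
    \<le> int (nverts v) * (int (nverts v) + 1)" for v :: "'a rtree"
    using sum_nverts_le[of v, THEN of_nat_mono[where 'a = int]] by (simp add: algebra_simps)
  have eq: "caterpillar v"
    if "int (nverts v) * (int (nverts v) + 1) \<le> 2 * int (sum_nverts v) + 2 * (int (half_odd v))\<^sup>2"
      for v :: "'a rtree"
  proof (rule caterpillar_if_sum_nverts_eq)
    have "int (2 * sum_nverts v + 2 * (half_odd v)\<^sup>2) = int (nverts v * (nverts v + 1))"
      using that le[of v] by (simp add: algebra_simps)
    then show "2 * sum_nverts v + 2 * (half_odd v)\<^sup>2 = nverts v * (nverts v + 1)"
      by (simp only: of_nat_eq_iff)
  qed
  have hk: "int k - 1 = int (half_odd u + half_odd w)" "k - 1 = half_odd u + half_odd w"
    using h(1) by auto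
  note bal = sum_squares_balanced(1)[of "half_odd u" "half_odd w"]
  \<comment> \<open>In the exceptional case the parts have orders \<open>k - 1\<close> and
    \<open>k + 1\<close>, and both sides of the identity are \<open>2 * k^2\<close>, as for a
    balanced split.\<close>
  have "int (nverts u) * (int (nverts u) + 1) + int (nverts w) * (int (nverts w) + 1) - 2 * int
    (nverts w) =
    2 * int M * (int n - int M)"
  proof (cases "M \<le> nverts u")
    case True
    have u: "nverts u = M" using True uw(2) h(2) by (simp add: M_def n_def)
    then have "nverts w = M \<or> nverts w = M + 1" "int n - int M = int (nverts w)"
      using h(2) by (auto simp: M_def n_def)
    then show ?thesis using u by (auto simp: algebra_simps)
  next
    case False
    then have ex: "n = 2 * k" "even k" "k - 1 \<le> nverts u" "M = k" using uw(3)
      by (auto simp: M_def n_def)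
    then have u: "nverts u = k - 1" "nverts w = k + 1" using False h(2) k by auto
    then show ?thesis using ex k by (auto simp: algebra_simps of_nat_diff)
  qed
  \<comment> \<open>\<open>large\<close> meets the upper bounds for both parts and for the squares,
    so all of these are equalities.\<close>
  then have fin_eq: "caterpillar u" "caterpillar w"
    "2 * (int (half_odd u))\<^sup>2 + 2 * (int (half_odd w))\<^sup>2 =
      int ((half_odd u + half_odd w) mod 2) + (int (half_odd u + half_odd w))\<^sup>2"
    using sq le[of u] le[of w] bal large[unfolded hk] by (auto intro!: eq)
  then have "half_odd u = (k - 1) div 2 \<or> half_odd w = (k - 1) div 2"
    unfolding hk(2) by (intro sum_squares_balanced(2))
  then show ?thesis
  proof
    assume "half_odd w = (k - 1) div 2"
    then show ?thesis using that[OF uw(1) fin_eq(1,2)] hk(2) by simp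
  next
    assume "half_odd u = (k - 1) div 2"
    moreover have "attach w u \<approx> t" using uw(1) attach_commute rerooting_trans by blast
    ultimately show ?thesis using that[of w u] fin_eq(1,2) hk(2) by simp
  qed
qed

section \<open>Caterpillars and the graph C\<close>

text \<open>Caterpillars with the pendent vertex normalised to be the first child, which makes the
  shape unique.\<close>

inductive comb :: "'a rtree \<Rightarrow> bool" where
  leaf: "comb (Node x [])"
| stem: "comb t \<Longrightarrow> comb (Node x [t])"
| fork: "comb t \<Longrightarrow> nverts t = 2 * half_odd t + 1 \<Longrightarrow> comb (Node x [Node y [], t])"

lemma parcs_attach:
  "parcs (tree_graph (attach u w)) =
    {(root_of u, root_of w), (root_of w, root_of u)} \<union> parcs (tree_graph u) \<union> parcs (tree_graph w)"
  by (auto simp: tree_arcs_attach)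

lemma attach_cong:
  assumes "u' \<approx> u" "w' \<approx> w" "root_of u' = root_of u" "root_of w' = root_of w"
  shows "attach u' w' \<approx> attach u w"
proof -
  have "parcs (tree_graph (attach u' w')) = parcs (tree_graph (attach u w))"
    unfolding parcs_attach using assms by (simp only: rerooting_def)
  moreover have m: "mset (labels (attach u' w')) = mset (labels (attach u w))"
    using assms by (simp add: labels_attach rerooting_def)
  ultimately show ?thesis
    using mset_eq_setD[OF m] by (simp add: rerooting_def tree_graph_def)
qed

lemma caterpillar_obtains_comb:
  "caterpillar t \<Longrightarrow> \<exists>t'. comb t' \<and> t' \<approx> t \<and> root_of t' = root_of t \<and> half_odd t' = half_odd t"
proof (induction t rule: caterpillar.induct)
  case (leaf x)
  then show ?case using comb.leaf[of x] rerooting_refl by blast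
next
  case (stem t x)
  then obtain t' where t': "comb t'" "t' \<approx> t" "root_of t' = root_of t" "half_odd t' = half_odd t"
    by blast
  have "Node x [t'] \<approx> Node x [t]"
    using attach_cong[OF t'(2) rerooting_refl t'(3), of "Node x []"] by (simp add: attach_def)
  then show ?case using comb.stem[OF t'(1), of x] t' by (intro exI[of _ "Node x [t']"]) simp
next
  case (fork t x y)
  then obtain t' where t': "comb t'" "t' \<approx> t" "root_of t' = root_of t" "half_odd t' = half_odd t"
    by blast
  have "Node x [t'] \<approx> Node x [t]"
    using attach_cong[OF t'(2) rerooting_refl t'(3), of "Node x []"] by (simp add: attach_def)
  then have "Node x [Node y [], t'] \<approx> Node x [Node y [], t]"
    using attach_cong[of "Node y []" "Node y []" "Node x [t']" "Node x [t]"]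
      by (simp add: attach_def)
  then show ?case
    using comb.fork[OF t'(1), of x y] rerooting_nverts[OF t'(2)] fork.hyps t'
    by (intro exI[of _ "Node x [Node y [], t']"]) simp
next
  case (fork' t x y)
  then obtain t' where t': "comb t'" "t' \<approx> t" "root_of t' = root_of t" "half_odd t' = half_odd t"
    by blast
  have "Node x [t'] \<approx> Node x [t]"
    using attach_cong[OF t'(2) rerooting_refl t'(3), of "Node x []"] by (simp add: attach_def)
  then have "Node x [Node y [], t'] \<approx> Node x [Node y [], t]"
    using attach_cong[of "Node y []" "Node y []" "Node x [t']" "Node x [t]"]
      by (simp add: attach_def)
  also have "Node x [Node y [], t] \<approx> Node x [t, Node y []]"
    by (rule rerooting_mset) (simp add: add_mset_commute)
  finally show ?case
    using comb.fork[OF t'(1), of x y] rerooting_nverts[OF t'(2)] fork'.hyps t'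
    by (intro exI[of _ "Node x [Node y [], t']"]) simp
qed

section \<open>Shapes and relabellings of rooted trees\<close>

abbreviation shape :: "'a rtree \<Rightarrow> unit rtree" where
  "shape \<equiv> map_rtree (\<lambda>_. ())"

text \<open>The order exceeds \<open>2 * half_odd t + 1\<close> exactly if the top is a stem, so the
  two numbers determine the tree from the top down.\<close>

lemma comb_shape_unique:
  "comb t \<Longrightarrow> comb t' \<Longrightarrow> nverts t = nverts t' \<Longrightarrow> half_odd t = half_odd t' \<Longrightarrow> shape t = shape t'"
proof (induction t arbitrary: t' rule: comb.induct)
  case (leaf x)
  from leaf(1) show ?case
    by (cases rule: comb.cases) (use leaf in \<open>auto simp: nverts_neq_0\<close>)
next
  case (stem t x)
  note le = half_odd_le[of t]
  from stem.prems(1) show ?case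
    by (cases rule: comb.cases) (use stem le nverts_pos[of t] in auto)
next
  case (fork t x y)
  from fork.prems(1) show ?case
  proof (cases rule: comb.cases)
    case (stem s z)
    then show ?thesis using fork half_odd_le[of s] by simp
  qed (use fork nverts_pos[of t] in auto)
qed

lemma labels_map_rtree: "labels (map_rtree f t) = map f (labels t)"
  by (induction t) (simp add: map_concat o_def cong: map_cong)

lemma nverts_map_rtree [simp]: "nverts (map_rtree f t) = nverts t"
  by (metis labels_map_rtree length_labels length_map)

lemma half_odd_map_rtree [simp]: "half_odd (map_rtree f t) = half_odd t"
  by (induction t) (simp add: o_def cong: map_cong)

lemma root_of_map_rtree [simp]: "root_of (map_rtree f t) = f (root_of t)"
  by (cases t) simp

lemma tree_arcs_map_rtree: "tree_arcs (map_rtree f t) = map_prod f f ` tree_arcs t"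
proof (induction t)
  case (Node x ts)
  then show ?case by (auto simp: tree_arcs_Node image_UN)
qed

lemma attach_map_rtree: "map_rtree f (attach u w) = attach (map_rtree f u) (map_rtree f w)"
  by (cases w) (simp add: attach_def)

lemma side_sum_map_rtree: "side_sum (map_rtree f t) = side_sum t"
proof -
  have "branch_orders (map_rtree f t) = branch_orders t"
    by (induction t) (simp add: o_def cong: map_cong)
  then show ?thesis by (simp add: side_sum_def)
qed

text \<open>Trees of equal shape have label lists of equal length, so the concatenated lists split
  at the same places.\<close>

lemma map_rtree_eq_if_labels:
  "shape t = shape t' \<Longrightarrow> map f (labels t) = labels t' \<Longrightarrow> map_rtree f t = t'"
proof (induction t arbitrary: t')
  case (Node x ts)
  obtain y us where t': "t' = Node y us" by (cases t')
  have "map (map_rtree f) ts = us" if "map shape ts = map shape us"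
    "map f (concat (map labels ts)) = concat (map labels us)"
    "\<And>t t'. t \<in> set ts \<Longrightarrow> shape t = shape t' \<Longrightarrow> map f (labels t) = labels t' \<Longrightarrow> map_rtree f t = t'"
      for ts us
    using that
  proof (induction ts arbitrary: us)
    case (Cons t ts)
    then obtain u us' where us: "us = u # us'" "shape t = shape u" "map shape ts = map shape us'"
      by auto
    have "length (map f (labels t)) = length (labels u)"
      using us(2) by (metis length_labels length_map nverts_map_rtree)
    then have "map f (labels t) = labels u"
      "map f (concat (map labels ts)) = concat (map labels us')"
      using Cons.prems(2) us(1) by auto
    then show ?case using Cons us by auto
  qed simp
  then show ?case using Node t' by auto
qed

lemma shape_eq_obtains_map_rtree:
  assumes "shape t = shape t'" "distinct (labels t)"
  obtains f where "map_rtree f t = t'"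
proof -
  let ?f = "the \<circ> map_of (zip (labels t) (labels t'))"
  have l: "length (labels t) = length (labels t')"
    using assms(1) by (metis length_labels nverts_map_rtree)
  have "map ?f (labels t) = labels t'"
  proof (rule nth_equalityI)
    fix i assume "i < length (map ?f (labels t))"
    then show "map ?f (labels t) ! i = labels t' ! i"
      using assms(2) l by (simp add: map_of_zip_nth)
  qed (use l in simp)
  then show ?thesis using that map_rtree_eq_if_labels[OF assms(1)] by blast
qed

lemma digraph_iso_map_rtree:
  assumes "distinct (labels (map_rtree f t))"
  shows "digraph_iso (with_proj (tree_graph t)) (with_proj (tree_graph (map_rtree f t)))"
proof -
  have inj: "inj_on f (set (labels t))" and d: "distinct (labels t)"
    using assms by (simp_all add: labels_map_rtree distinct_map)
  interpret pair_graph "tree_graph t" using pair_graph_tree_graph[OF d] .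
  let ?h = "\<lparr>iso_verts = f, iso_arcs = map_prod f f, iso_head = snd, iso_tail = fst\<rparr>"
  have "parcs (tree_graph t) \<subseteq> set (labels t) \<times> set (labels t)"
    using tree_arcs_labels by fastforce
  then have "inj_on (map_prod f f) (parcs (tree_graph t))"
    using map_prod_inj_on[OF inj inj] inj_on_subset by blast
  then have "digraph_isomorphism ?h"
    using inj wf_digraph by (simp add: digraph_isomorphism_def)
  moreover have "with_proj (tree_graph (map_rtree f t)) = app_iso ?h (with_proj (tree_graph t))"
    by (simp add: app_iso_def with_proj_def labels_map_rtree tree_arcs_map_rtree image_Un)
      force
  ultimately show ?thesis unfolding digraph_iso_def by blast
qed

section \<open>The graph C as two joined combs\<close>

text \<open>
  \<open>f\<close> enumerates the indices of the spine starting from its outer end: \<open>i + 1\<close> on the left side of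
    the
  splitting edge and \<open>m - i\<close> on the right side, where the spine is \<open>V 1, \<dots>, V m\<close>.
\<close>

primrec cvertex_comb :: "(nat \<Rightarrow> nat) \<Rightarrow> nat \<Rightarrow> nat \<Rightarrow> cvertex rtree" where
  "cvertex_comb f j 0 = Node (V (f 0)) []"
| "cvertex_comb f j (Suc i) = Node (V (f (Suc i)))
     (if i < j then [Node (U (f (Suc i))) [], cvertex_comb f j i] else [cvertex_comb f j i])"

lemma nverts_cvertex_comb [simp]: "nverts (cvertex_comb f j i) = i + 1 + min i j"
  by (induction i) auto

lemma half_odd_cvertex_comb [simp]: "half_odd (cvertex_comb f j i) = min i j"
  by (induction i) auto

lemma comb_cvertex_comb: "comb (cvertex_comb f j i)"
  by (induction i) (auto intro!: comb.intros)

lemma root_of_cvertex_comb [simp]: "root_of (cvertex_comb f j i) = V (f i)"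
  by (cases i) auto

lemma labels_cvertex_comb:
  "set (labels (cvertex_comb f j i)) = V ` f ` {..i} \<union> U ` f ` {1..min i j}"
proof (induction i)
  case (Suc i)
  have "{1..min (Suc i) j} = {1..min i j} \<union> (if i < j then {Suc i} else {})" by auto
  then show ?case by (auto simp: Suc.IH atMost_Suc)
qed simp

lemma distinct_labels_cvertex_comb:
  "inj_on f {..i} \<Longrightarrow> distinct (labels (cvertex_comb f j i))"
proof (induction i)
  case (Suc i)
  then have "inj_on f {..i}" using inj_on_subset by fastforce
  moreover have "f (Suc i) \<notin> f ` {..i}"
    using Suc.prems by (fastforce dest: inj_onD)
  ultimately show ?case using Suc.IH by (auto simp: labels_cvertex_comb)
qed simp

lemma tree_arcs_cvertex_comb:
  "tree_arcs (cvertex_comb f j i) =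
    (\<lambda>l. (V (f (Suc l)), V (f l))) ` {..<i} \<union> (\<lambda>l. (V (f l), U (f l))) ` {1..min i j}"
proof (induction i)
  case (Suc i)
  have "tree_arcs (cvertex_comb f j (Suc i)) =
      insert (V (f (Suc i)), V (f i)) (tree_arcs (cvertex_comb f j i)) \<union>
      (if i < j then {(V (f (Suc i)), U (f (Suc i)))} else {})"
    by (auto simp: tree_arcs_Node)
  moreover have "{1..min (Suc i) j} = {1..min i j} \<union> (if i < j then {Suc i} else {})" by auto
  ultimately show ?case unfolding Suc.IH lessThan_Suc by auto
qed (simp add: tree_arcs_Node)

lemma image_diff_atLeastAtMost:
  "y \<le> m \<Longrightarrow> (\<lambda>i. m - i) ` {x..y} = {m - y..m - x}" if "x \<le> m" for x y m :: nat
proof (intro equalityI subsetI)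
  fix z assume "y \<le> m" "z \<in> {m - y..m - x}"
  then have "z = m - (m - z)" "m - z \<in> {x..y}" using that by auto
  then show "z \<in> (\<lambda>i. m - i) ` {x..y}" by (rule image_eqI)
qed auto

text \<open>The splitting edge joins \<open>V p\<close> and \<open>V (p + 1)\<close> and may lie
  anywhere between the two pendent ranges. This allows a nearly balanced split as well as the one
  dictated by an optimal tree.\<close>

lemma C_graph_eq_tree_graph:
  assumes "a < p" "p + b < m" "m = n - a - b"
  defines "u \<equiv> cvertex_comb Suc a (p - 1)" and "w \<equiv> cvertex_comb (\<lambda>i. m - i) b (m - p - 1)"
  shows "tree_graph (attach u w) = C_graph n a b" "distinct (labels (attach u w))"
proof -
  have min: "min (p - 1) a = a" "min (m - p - 1) b = b" using assms(1,2) by auto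
  have Vu: "Suc ` {..p - 1} = {1..p}"
    using assms(1) by (simp add: image_Suc_atMost)
  have Vw: "(\<lambda>i. m - i) ` {..m - p - 1} = {p + 1..m}"
    using assms(2) image_diff_atLeastAtMost[of 0 m "m - p - 1"] by (simp add: atMost_atLeast0)
  have Uu: "Suc ` {1..a} = {2..a + 1}"
    by (simp add: numeral_2_eq_2)
  have Uw: "(\<lambda>i. m - i) ` {1..b} = {m - b..m - 1}"
    using assms(2) image_diff_atLeastAtMost[of 1 m b] by simp
  have pend: "pendant_indices n a b = {2..a + 1} \<union> {m - b..m - 1}"
    unfolding pendant_indices_def assms(3) by (simp add: mult_2 add.assoc)
  have Lu: "set (labels u) = V ` {1..p} \<union> U ` {2..a + 1}"
    unfolding u_def labels_cvertex_comb min Vu Uu ..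
  have Lw: "set (labels w) = V ` {p + 1..m} \<union> U ` {m - b..m - 1}"
    unfolding w_def labels_cvertex_comb min Vw Uw ..
  have du: "distinct (labels u)" unfolding u_def by (rule distinct_labels_cvertex_comb) simp
  have dw: "distinct (labels w)" unfolding w_def
    by (rule distinct_labels_cvertex_comb) (use assms(2) in \<open>auto simp: inj_on_def\<close>)
  show "distinct (labels (attach u w))"
    unfolding distinct_labels_attach Lu Lw using du dw assms(1,2) by auto
  let ?E = "{(V i, V (i + 1)) |i. 1 \<le> i \<and> i < m} \<union> {(V i, U i) |i. i \<in> pendant_indices n a b}"
  have Au: "tree_arcs u = (\<lambda>i. (V (i + 1), V i)) ` {1..<p} \<union> (\<lambda>i. (V i, U i)) ` {2..a + 1}"
  proof -
    have "(\<lambda>l. (V (Suc (Suc l)), V (Suc l))) ` {..<p - 1}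
      = (\<lambda>i. (V (i + 1), V i)) ` Suc ` {..<p - 1}"
      by (simp add: image_image)
    also have "Suc ` {..<p - 1} = {1..<p}"
      using assms(1) by (auto simp: image_Suc_lessThan)
    finally show ?thesis
      unfolding u_def tree_arcs_cvertex_comb min Uu[symmetric] image_image by simp
  qed
  have Aw: "tree_arcs w = (\<lambda>i. (V i, V (i + 1))) ` {p + 1..<m} \<union> (\<lambda>i. (V i, U i)) ` {m - b..m - 1}"
  proof -
    have "(\<lambda>l. (V (m - Suc l), V (m - l))) ` {..<m - p - 1} =
        (\<lambda>i. (V i, V (i + 1))) ` (\<lambda>l. m - Suc l) ` {..<m - p - 1}"
      unfolding image_image by (intro image_cong) (auto simp: Suc_diff_Suc)
    also have "(\<lambda>l. m - Suc l) ` {..<m - p - 1} = {p + 1..<m}"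
    proof -
      have "(\<lambda>l. m - Suc l) ` {..<m - p - 1} = (\<lambda>i. m - i) ` Suc ` {..<m - p - 1}"
        by (simp only: image_image)
      also have "\<dots> = {m - (m - p - 1)..m - 1}"
        unfolding image_Suc_lessThan using assms(2) by (intro image_diff_atLeastAtMost) auto
      also have "\<dots> = {p + 1..<m}" using assms(2) by auto
      finally show ?thesis .
    qed
    finally show ?thesis
      unfolding w_def tree_arcs_cvertex_comb min Uw[symmetric] image_image by simp
  qed
  have r: "root_of u = V p" "root_of w = V (p + 1)"
    using assms(1,2) by (auto simp: u_def w_def)
  have split: "{(V i, V (i + 1)) |i. 1 \<le> i \<and> i < m} =
      (\<lambda>i. (V i, V (i + 1))) ` {1..<p} \<union> {(V p, V (p + 1))} \<union> (\<lambda>i. (V i, V (i + 1))) ` {p + 1..<m}"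
  proof -
    have "{1..<m} = {1..<p} \<union> {p} \<union> {p + 1..<m}" using assms(1,2) by auto
    moreover have "{(V i, V (i + 1)) |i. 1 \<le> i \<and> i < m} = (\<lambda>i. (V i, V (i + 1))) ` {1..<m}" by auto
    ultimately show ?thesis by (simp add: image_Un)
  qed
  have "parcs (tree_graph (attach u w)) = ?E \<union> ?E\<inverse>"
    unfolding split pend tree_graph_simps tree_arcs_attach Au Aw r by auto
  moreover have "pverts (tree_graph (attach u w)) = V ` {1..m} \<union> U ` pendant_indices n a b"
  proof -
    have "{1..m} = {1..p} \<union> {p + 1..m}" using assms(1,2) by auto
    then show ?thesis unfolding pend by (auto simp: set_labels_attach Lu Lw)
  qed
  ultimately show "tree_graph (attach u w) = C_graph n a b"
    unfolding C_graph_def assms(3)[symmetric] Let_def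
    by (intro pair_pre_digraph.equality) simp_all
qed

lemma ceiling_floor_half_pred:
  assumes "1 \<le> k"
  shows "nat \<lceil>(real k - 1) / 2\<rceil> = k - 1 - (k - 1) div 2" "nat \<lfloor>(real k - 1) / 2\<rfloor> = (k - 1) div 2"
proof -
  obtain j where j: "k = Suc j" using assms by (cases k) auto
  have f: "\<lfloor>real j / 2\<rfloor> = int (j div 2)"
    using floor_divide_of_nat_eq[of j 2, where 'a = real] by simp
  have "\<lceil>real j / 2\<rceil> = int (j - j div 2)"
  proof (cases "even j")
    case True
    then show ?thesis by (auto elim!: evenE)
  next
    case False
    then obtain i where "j = 2 * i + 1" by (elim oddE)
    then show ?thesis by (simp add: ceiling_unique)
  qed
  then show "nat \<lceil>(real k - 1) / 2\<rceil> = k - 1 - (k - 1) div 2"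
    "nat \<lfloor>(real k - 1) / 2\<rfloor> = (k - 1) div 2"
    using f j by simp_all
qed

text \<open>The orders of the parts differ by 0, 1 or 2; difference 2 is needed for
  \<open>n = 2 * k\<close> with \<open>k\<close> even.\<close>

lemma side_sum_attach_combs:
  fixes u w :: "'a rtree"
  defines "M \<equiv> (nverts u + nverts w) div 2"
  assumes "comb u" "comb w" "nverts w \<le> nverts u" "nverts u \<le> M + 1"
  shows "2 * int (side_sum (attach u w)) =
    2 * int M * (int (nverts u + nverts w) - int M) - 2 * (int (half_odd u))\<^sup>2 - 2 * (int
      (half_odd w))\<^sup>2"
proof -
  have eq: "2 * int (sum_nverts t)
    = int (nverts t) * (int (nverts t) + 1) - 2 * (int (half_odd t))\<^sup>2"
    if "comb t" for t :: "'a rtree"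
  proof -
    have "caterpillar t" using that by induction (auto intro: caterpillar.intros)
    then have "int (2 * sum_nverts t + 2 * (half_odd t)\<^sup>2) = int (nverts t * (nverts t + 1))"
      using caterpillar_sum_nverts by metis
    then show ?thesis by (simp add: algebra_simps)
  qed
  have "side_sum (attach u w) + nverts u = sum_nverts u + sum_nverts w"
    using side_sum_attach_eq[of u w] assms by simp
  then have "2 * int (side_sum (attach u w)) = int (nverts u) * (int (nverts u) + 1) +
      int (nverts w) * (int (nverts w) + 1) - 2 * int (nverts u) - 2 * (int (half_odd u))\<^sup>2 - 2 *
        (int (half_odd w))\<^sup>2"
    using eq[OF assms(2)] eq[OF assms(3)] by linarith
  moreover consider "nverts u = nverts w" "M = nverts w" | "nverts u = nverts w + 1" "M = nverts w"
    | "nverts u = nverts w + 2" "M = nverts w + 1"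
    using assms(4,5) unfolding M_def by linarith
  then have "int (nverts u) * (int (nverts u) + 1) +
      int (nverts w) * (int (nverts w) + 1) - 2 * int (nverts u)
        = 2 * int M * (int (nverts u + nverts w) - int M)"
    by cases (simp_all add: algebra_simps)
  ultimately show ?thesis by simp
qed

theorem theorem3p2:
  fixes n k :: nat and T :: "'a pair_pre_digraph"
  assumes "1 \<le> k" and "k \<le> n div 2"
    and "T \<in> odd_trees n k"
    and "\<forall>T' :: 'a pair_pre_digraph \<in> odd_trees n k. mostar T \<le> mostar T'"
  shows "digraph_iso (with_proj T)
    (with_proj (C_graph n (nat \<lceil>(real k - 1) / 2\<rceil>) (nat \<lfloor>(real k - 1) / 2\<rfloor>)))"
proof -
  define b where "b = (k - 1) div 2"
  define a where "a = k - 1 - b"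
  define M where "M = n div 2"
  have ab: "a + b = k - 1" "b \<le> a" "a \<le> b + 1" by (auto simp: a_def b_def)
  have n: "k \<le> M" "2 * M \<le> n" "n \<le> 2 * M + 1" using assms(2) by (auto simp: M_def)
  define m where "m = n - a - b"
  define L where "L p = cvertex_comb Suc a (p - 1)" for p
  define R where "R p = cvertex_comb (\<lambda>i. m - i) b (m - p - 1)" for p
  have C: "tree_graph (attach (L p) (R p)) = C_graph n a b" "distinct (labels (attach (L p) (R p)))"
    "comb (L p)" "comb (R p)" "half_odd (L p) = a" "half_odd (R p) = b"
    "nverts (L p) = p + a" "nverts (R p) + p + a = n" if "a < p" "p + b < m" for p
    using C_graph_eq_tree_graph[OF that m_def] that comb_cvertex_comb
    by (auto simp: L_def R_def m_def)

  obtain t where t: "distinct (labels t)" "tree_graph t = T"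
    using assms(3) undirected_tree_obtains_rtree unfolding odd_trees_def by blast
  have nt: "nverts t = n"
    using assms(3) t distinct_card[OF t(1)] by (auto simp: odd_trees_def)

  \<comment> \<open>The order of the left part of the competitor. It must be at least
    \<open>2 * a + 1\<close>, which half of \<open>n\<close>, rounded up, satisfies except if
    \<open>n = 2 * k\<close> with \<open>k\<close> even.\<close>
  define s where "s = (if 2 * a + 1 \<le> n - M then n - M else M + 1)"
  define p where "p = s - a"
  have s: "2 * a + 1 \<le> s" "n \<le> s + s" "s \<le> M + 1" "s + 2 * b + 1 \<le> n"
  proof -
    consider "2 * a + 1 \<le> n - M" | "n - M < 2 * a + 1" by linarith
    then show "2 * a + 1 \<le> s" "n \<le> s + s" "s \<le> M + 1" "s + 2 * b + 1 \<le> n"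
      using n ab assms(1) unfolding s_def by (cases; simp; linarith)+
  qed
  then have p: "a < p" "p + b < m" using ab n assms(1) by (auto simp: p_def m_def)
  note Cp = C[OF p]
  define c where "c = attach (L p) (R p)"
  have nc: "nverts c = n" using Cp(7,8) by (simp add: c_def nverts_attach)
  then have "card (set (labels c)) = card (set (labels t))"
    using nt Cp(2) t(1) by (simp add: c_def distinct_card)
  \<comment> \<open>Minimality concerns trees over the vertex type of \<open>T\<close> only, so the
    competitor is relabelled by the vertices of \<open>T\<close>.\<close>
  then obtain g where g: "bij_betw g (set (labels c)) (set (labels t))"
    using finite_same_card_bij by blast
  define c' where "c' = map_rtree g c"
  have dc: "distinct (labels c')"
    using g Cp(2) by (simp add: c'_def c_def labels_map_rtree distinct_map bij_betw_def)
  have c': "c' = attach (map_rtree g (L p)) (map_rtree g (R p))"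
    by (simp add: c'_def c_def attach_map_rtree)
  have "card (odd_vertices (tree_graph c')) = 2 * k"
    using card_odd_vertices_attach[OF dc[unfolded c']] Cp(5,6) ab(1) assms(1) unfolding c' by simp
  moreover have "card (pverts (tree_graph c')) = n"
    using distinct_card[OF dc] nc by (simp add: c'_def)
  ultimately have "tree_graph c' \<in> odd_trees n k"
    using undirected_tree_tree_graph[OF dc] by (simp add: odd_trees_def)
  then have "mostar (tree_graph t) \<le> mostar (tree_graph c')" using assms(4) t(2) by blast
  then have "side_sum c' \<le> side_sum t"
    using mostar_tree_graph[OF t(1)] mostar_tree_graph[OF dc] nt nc
    by (simp add: c'_def)
  then have "side_sum c \<le> side_sum t" by (simp add: c'_def side_sum_map_rtree)
  moreover have "2 * int (side_sum c) = 2 * int M * (int n - int M) - 2 * (int a)\<^sup>2 - 2 * (int b)\<^sup>2"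
  proof -
    have "nverts (L p) = s" "nverts (R p) = n - s" "nverts (L p) + nverts (R p) = n"
      using Cp(7,8) s by (auto simp: p_def)
    then show ?thesis
      using side_sum_attach_combs[OF Cp(3,4)] s Cp(5,6) unfolding c_def by (simp add: M_def)
  qed
  moreover have "2 * (int a)\<^sup>2 + 2 * (int b)\<^sup>2 = (int k - 1)\<^sup>2 + int ((k - 1) mod 2)"
  proof -
    have k: "int k - 1 = int a + int b" using ab(1) assms(1) by linarith
    have "(b + b) mod 2 = 0" "(b + 1 + b) mod 2 = 1" by presburger+
    moreover have "a = b \<or> a = b + 1" using ab(2,3) by linarith
    ultimately have "(a + b) mod 2 = a - b" by auto
    then show ?thesis
      using \<open>a = b \<or> a = b + 1\<close> unfolding k ab(1)[symmetric]
      by (auto simp: power2_eq_square algebra_simps)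
  qed
  ultimately have "2 * int M * (int n - int M)
    \<le> 2 * int (side_sum t) + (int k - 1)\<^sup>2 + int ((k - 1) mod 2)"
    by linarith
  moreover have "card (odd_vertices (tree_graph t)) = 2 * k"
    using assms(3) t(2) by (simp add: odd_trees_def)
  ultimately obtain u w where uw: "attach u w \<approx> t" "caterpillar u" "caterpillar w"
    "half_odd u = a" "half_odd w = b"
    using extremal_split[OF t(1), of k] nt assms(1) n(1) by (auto simp: M_def a_def b_def)
  obtain u' where u': "comb u'" "u' \<approx> u" "root_of u' = root_of u" "half_odd u' = a"
    using caterpillar_obtains_comb[OF uw(2)] uw(4) by auto
  obtain w' where w': "comb w'" "w' \<approx> w" "root_of w' = root_of w" "half_odd w' = b"
    using caterpillar_obtains_comb[OF uw(3)] uw(5) by auto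
  have r: "attach u' w' \<approx> t"
    using attach_cong[OF u'(2) w'(2) u'(3) w'(3)] uw(1) rerooting_trans by blast
  then have d: "distinct (labels (attach u' w'))" using t(1) rerooting_distinct by blast
  have nuw: "nverts u' + nverts w' = n"
    using rerooting_nverts[OF r] nt by (simp add: nverts_attach)
  \<comment> \<open>The left comb has \<open>a\<close> pendent vertices beside its spine, so its
    spine has \<open>q\<close> vertices, and \<open>C_graph\<close> is split after the same
    number.\<close>
  define q where "q = nverts u' - a"
  have q: "a < q" "q + b < m"
    using half_odd_le[of u'] half_odd_le[of w'] u'(4) w'(4) nuw by (auto simp: q_def m_def)
  note Cq = C[OF q]
  have "nverts u' = nverts (L q)" "nverts w' = nverts (R q)"
    using Cq(7,8) half_odd_le[of u'] u'(4) nuw by (auto simp: q_def)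
  then have "shape u' = shape (L q)" "shape w' = shape (R q)"
    using comb_shape_unique u' w' Cq(3-6) by metis+
  then have "shape (attach u' w') = shape (attach (L q) (R q))" by (simp add: attach_map_rtree)
  then obtain f where f: "map_rtree f (attach u' w') = attach (L q) (R q)"
    using shape_eq_obtains_map_rtree d by metis
  have "digraph_iso (with_proj (tree_graph (attach u' w'))) (with_proj (tree_graph (attach (L q)
    (R q))))"
    using digraph_iso_map_rtree[of f "attach u' w'"] Cq(2) f by simp
  then have "digraph_iso (with_proj T) (with_proj (C_graph n a b))"
    using rerooting_graph[OF r] Cq(1) t(2) by simp
  then show ?thesis
    unfolding ceiling_floor_half_pred[OF assms(1)] a_def b_def .
qed

end
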